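(* Let $T\subset\mathbb{R}^2$ (the table) be a closed solid rectangle whose shorter side has length at least $1$, and let the laptop be a closed solid rectangle with side lengths $1$ and $L$, where $L\ge 1$. Consider all placements of the laptop, i.e. all sets $R\subset\mathbb{R}^2$ congruent to a $1\times L$ rectangle whose midpoint belongs to $T$, and for each placement $R$ consider the area of its footprint $R\cap T$. Then the minimum of the footprint area over all placements is attained, and: (1) if $L>1$ (the laptop is not a square), a placement $R$ has minimal footprint area if and only if the midpoint of $R$ coincides with one of the four corners of $T$ and the footprint $R\cap T$ is an isosceles right triangle; (2) if $L=1$ (the laptop is a square), a placement $R$ has minimal footprint area if and only if the midpoint of $R$ coincides with one of the four corners of $T$.
   Context: The laptop and the table are modelled as solid (filled) rectangles in the plane. The midpoint of a rectangle is its center of symmetry (the intersection of its diagonals), taken as the laptop's center of gravity. The width of a rectangle is the length of its shorter side (of any side, if it is a square). A placement of the laptop is any position (arbitrary translation and rotation in the plane) of the laptop rectangle for which its midpoint is a point of the table. The footprint of a placement is the common region (intersection) of the laptop and the table. *)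

theory Defs
  imports "HOL-Analysis.Analysis"
begin

definition is_rectangle :: "real ^ 2 \<Rightarrow> real ^ 2 \<Rightarrow> real ^ 2 \<Rightarrow> real ^ 2 \<Rightarrow> bool"
  where "is_rectangle A B C D \<longleftrightarrow>
    A \<noteq> B \<and> A \<noteq> D \<and> orthogonal (B - A) (D - A) \<and> C - D = B - A"

definition is_solid_rectangle :: "real \<Rightarrow> real \<Rightarrow> (real ^ 2) set \<Rightarrow> bool"
  where "is_solid_rectangle a b S \<longleftrightarrow>
    (\<exists>A B C D. is_rectangle A B C D \<and> dist A B = a \<and> dist A D = b \<and>
       S = convex hull {A, B, C, D})"

(* Invariance under the point reflection in m.  On a nonempty bounded set at most one m
   qualifies; on a solid rectangle it is the intersection of the diagonals, see below. *)
definition is_center_of_symmetry :: "real ^ 2 \<Rightarrow> (real ^ 2) set \<Rightarrow> bool"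
  where "is_center_of_symmetry m S \<longleftrightarrow> (\<lambda>x. 2 *\<^sub>R m - x) ` S = S"

definition is_placement :: "real \<Rightarrow> (real ^ 2) set \<Rightarrow> (real ^ 2) set \<Rightarrow> bool"
  where "is_placement L T R \<longleftrightarrow>
    is_solid_rectangle 1 L R \<and> (\<exists>m\<in>T. is_center_of_symmetry m R)"

definition footprint_area :: "(real ^ 2) set \<Rightarrow> (real ^ 2) set \<Rightarrow> real"
  where "footprint_area T R = measure lebesgue (R \<inter> T)"

definition is_isosceles_right_triangle :: "(real ^ 2) set \<Rightarrow> bool"
  where "is_isosceles_right_triangle S \<longleftrightarrow>
    (\<exists>P Q R. P \<noteq> Q \<and> orthogonal (Q - P) (R - P) \<and> dist P Q = dist P R \<and>
       S = convex hull {P, Q, R})"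

lemma center_of_symmetry_unique:
  assumes "is_center_of_symmetry m S" "is_center_of_symmetry n S" "bounded S" "S \<noteq> {}"
  shows "m = n"
proof (rule ccontr)
  assume "m \<noteq> n"
  define d where "d = 2 *\<^sub>R (n - m)"
  have pos: "norm d > 0" using \<open>m \<noteq> n\<close> by (simp add: d_def)
  obtain x where x: "x \<in> S" using assms(4) by blast
  have shift: "y + d \<in> S" if "y \<in> S" for y
  proof -
    have "2 *\<^sub>R m - y \<in> S"
      using assms(1) that unfolding is_center_of_symmetry_def by blast
    then have "2 *\<^sub>R n - (2 *\<^sub>R m - y) \<in> S"
      using assms(2) unfolding is_center_of_symmetry_def by blast
    then show ?thesis by (simp add: d_def algebra_simps)
  qed
  have iter: "x + real k *\<^sub>R d \<in> S" for k
  proof (induction k)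
    case 0
    show ?case using x by simp
  next
    case (Suc k)
    then show ?case using shift[of "x + real k *\<^sub>R d"] by (simp add: algebra_simps)
  qed
  obtain B where B: "\<And>y. y \<in> S \<Longrightarrow> norm y \<le> B"
    using assms(3) by (auto simp: bounded_iff)
  obtain k :: nat where k: "B + norm x < real k * norm d"
    using pos reals_Archimedean3 by blast
  have "real k * norm d = norm ((x + real k *\<^sub>R d) - x)" by simp
  also have "\<dots> \<le> norm (x + real k *\<^sub>R d) + norm x" by (rule norm_triangle_ineq4)
  also have "\<dots> \<le> B + norm x" using B[OF iter] by simp
  finally show False using k by simp
qed

lemma center_of_symmetry_rectangle:
  assumes "is_rectangle A B C D"
  shows "is_center_of_symmetry m (convex hull {A, B, C, D}) \<longleftrightarrow> m = midpoint A C"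
    and "midpoint A C = midpoint B D"
proof -
  have C: "C = B + D - A" using assms by (simp add: is_rectangle_def algebra_simps)
  have two: "2 *\<^sub>R midpoint A C = B + D" by (simp add: midpoint_def C)
  show "midpoint A C = midpoint B D" by (simp add: midpoint_def C)
  have "(\<lambda>x. 2 *\<^sub>R midpoint A C - x) ` (convex hull {A, B, C, D})
      = (\<lambda>x. (B + D) + x) ` ((\<lambda>x. - 1 *\<^sub>R x) ` (convex hull {A, B, C, D}))"
    by (simp add: image_image two)
  also have "\<dots> = convex hull ((\<lambda>x. (B + D) + x) ` (\<lambda>x. - 1 *\<^sub>R x) ` {A, B, C, D})"
    by (simp only: convex_hull_scaling convex_hull_translation)
  also have "(\<lambda>x. (B + D) + x) ` (\<lambda>x. - 1 *\<^sub>R x) ` {A, B, C, D} = {A, B, C, D}"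
    by (auto simp: C)
  finally have "is_center_of_symmetry (midpoint A C) (convex hull {A, B, C, D})"
    by (simp add: is_center_of_symmetry_def)
  moreover have "bounded (convex hull {A, B, C, D})"
    by (simp add: bounded_convex_hull)
  ultimately show "is_center_of_symmetry m (convex hull {A, B, C, D}) \<longleftrightarrow> m = midpoint A C"
    using center_of_symmetry_unique[of m "convex hull {A, B, C, D}" "midpoint A C"] by auto
qed

end

theory Submission
  imports Defs
begin

text \<open>
  Write the table as \<open>-p \<le> x \<le> p'\<close>, \<open>-q \<le> y \<le> q'\<close> in coordinates centred at the midpoint of
  the laptop, with \<open>p \<le> p'\<close> and \<open>q \<le> q'\<close>.  The laptop contains a concentric unit square, and by
  the fourfold symmetry of the square each quadrant cuts it in area \<open>1/4\<close>.  If \<open>p\<close> and \<open>q\<close> are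
  small, the table contains the whole first-quadrant part of the square, and something more unless
  \<open>p = q = 0\<close>.  If \<open>p\<close> or \<open>q\<close> is at least \<open>0.29\<close>, two boxes of total area above \<open>1/4\<close> fit in
  the part of the table within distance \<open>1/2\<close> of the midpoint.  At a corner, a long laptop
  sticks out of the unit square inside the quadrant unless its short axis is the diagonal.
  Conversely, if the footprint at a corner is an isosceles right triangle with legs \<open>t\<close> and
  \<open>(c, s)\<close> is the unit direction of the side of length 1, then \<open>t\<bar>c\<bar>, t\<bar>s\<bar> \<le> 1/2\<close> gives
  \<open>t\<^sup>2 \<le> 1/2\<close>, so its area is at most \<open>1/4\<close>.
\<close>

section \<open>Orthonormal frames and boxes in frame coordinates\<close>

definition orthonormal :: "real ^ 2 \<Rightarrow> real ^ 2 \<Rightarrow> bool"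
  where "orthonormal e f \<longleftrightarrow> e \<bullet> e = 1 \<and> f \<bullet> f = 1 \<and> e \<bullet> f = 0"

text \<open>The lower bounds carry a minus sign so that, for an orthonormal frame and
  \<open>m\<close> inside, the four parameters are the distances from \<open>m\<close> to the
  sides.\<close>

definition oblong :: "real ^ 2 \<Rightarrow> real ^ 2 \<Rightarrow> real ^ 2 \<Rightarrow> real \<Rightarrow> real \<Rightarrow> real \<Rightarrow> real \<Rightarrow> (real ^ 2) set"
  where "oblong m e f p p' q q' =
    {z. - p \<le> (z - m) \<bullet> e \<and> (z - m) \<bullet> e \<le> p' \<and> - q \<le> (z - m) \<bullet> f \<and> (z - m) \<bullet> f \<le> q'}"

definition quadrant :: "real ^ 2 \<Rightarrow> real ^ 2 \<Rightarrow> real ^ 2 \<Rightarrow> (real ^ 2) set"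
  where "quadrant m e f = {z. 0 \<le> (z - m) \<bullet> e \<and> 0 \<le> (z - m) \<bullet> f}"

lemma inner_real2: "x \<bullet> y = x $ 1 * y $ 1 + x $ 2 * y $ 2" for x y :: "real ^ 2"
  by (simp add: inner_vec_def sum_2)

text \<open>The matrix with rows \<open>e\<close> and \<open>f\<close> is orthogonal, so its columns
  are orthonormal as well.\<close>

lemma orthonormal_components:
  assumes "orthonormal e f"
  shows "e $ 1 * e $ 1 + f $ 1 * f $ 1 = 1" "e $ 2 * e $ 2 + f $ 2 * f $ 2 = 1"
    "e $ 1 * e $ 2 + f $ 1 * f $ 2 = 0"
  using assms unfolding orthonormal_def inner_real2 by algebra+

lemma orthonormal_expansion:
  assumes "orthonormal e f"
  shows "(w \<bullet> e) *\<^sub>R e + (w \<bullet> f) *\<^sub>R f = w"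
proof -
  have "(w \<bullet> e) * e $ 1 + (w \<bullet> f) * f $ 1 = w $ 1"
    using orthonormal_components[OF assms] unfolding inner_real2 by algebra
  moreover have "(w \<bullet> e) * e $ 2 + (w \<bullet> f) * f $ 2 = w $ 2"
    using orthonormal_components[OF assms] unfolding inner_real2 by algebra
  ultimately show ?thesis by (simp add: vec_eq_iff forall_2)
qed

lemma orthonormal_inner:
  assumes "orthonormal e f"
  shows "w \<bullet> w' = (w \<bullet> e) * (w' \<bullet> e) + (w \<bullet> f) * (w' \<bullet> f)"
  by (subst orthonormal_expansion[OF assms, of w, symmetric]) (simp only: inner_simps, simp add: inner_commute)

text \<open>The determinant \<open>\<delta>\<close> of two perpendicular unit vectors is 1 or -1,
  and the second vector is \<open>\<delta>\<close> times the quarter turn of the first.\<close>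

lemma perp_unit_cases:
  fixes a b c d :: real
  assumes *: "a * a + b * b = 1" "c * c + d * d = 1" "a * c + b * d = 0"
  shows "c = - b \<and> d = a \<or> c = b \<and> d = - a"
proof -
  define \<delta> where "\<delta> = a * d - b * c"
  have "\<delta> * \<delta> = 1" using * unfolding \<delta>_def by algebra
  then have "\<delta> = 1 \<or> \<delta> = - 1" using square_eq_1_iff by blast
  moreover have "c = - \<delta> * b" using * unfolding \<delta>_def by algebra
  moreover have "d = \<delta> * a" using * unfolding \<delta>_def by algebra
  ultimately show ?thesis by auto
qed

lemma orthonormal_orient:
  assumes "orthonormal e f"
  shows "f $ 1 = - e $ 2 \<and> f $ 2 = e $ 1 \<or> f $ 1 = e $ 2 \<and> f $ 2 = - e $ 1"
  using assms by (intro perp_unit_cases) (simp_all add: orthonormal_def inner_real2)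

text \<open>The coordinates of \<open>u\<close> and \<open>v\<close> in the frame \<open>e\<close>,
  \<open>f\<close> again form perpendicular unit vectors, so the planar dichotomy applies to
  them.\<close>

lemma orthonormal_orient_frame:
  assumes "orthonormal e f" "orthonormal u v"
  shows "v \<bullet> e = - (u \<bullet> f) \<and> v \<bullet> f = u \<bullet> e \<or> v \<bullet> e = u \<bullet> f \<and> v \<bullet> f = - (u \<bullet> e)"
  using assms(2) by (intro perp_unit_cases)
    (simp_all add: orthonormal_def orthonormal_inner[OF assms(1), symmetric])

lemma orthonormal_swap: "orthonormal e f \<Longrightarrow> orthonormal f e"
  by (simp add: orthonormal_def inner_commute)

lemma orthonormal_minus: "orthonormal e f \<Longrightarrow> orthonormal (- e) f"
  by (simp add: orthonormal_def)

lemma orthonormal_minus_right: "orthonormal e f \<Longrightarrow> orthonormal e (- f)"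
  by (simp add: orthonormal_def)

text \<open>The linear map \<open>h\<close> sending the standard basis to \<open>e\<close>,
  \<open>f\<close> preserves inner products and carries an axis-parallel box onto the oblong, which
  inherits compactness and area.\<close>

lemma oblong_origin:
  assumes "orthonormal e f"
  shows "compact (oblong 0 e f p p' q q')"
    and "0 \<le> p + p' \<Longrightarrow> 0 \<le> q + q' \<Longrightarrow>
      measure lebesgue (oblong 0 e f p p' q q') = (p + p') * (q + q')"
proof -
  define h where "h w = (w $ 1) *\<^sub>R e + (w $ 2) *\<^sub>R f" for w :: "real ^ 2"
  have lin: "linear h"
    by (rule linearI) (simp_all add: h_def algebra_simps)
  have h: "h w \<bullet> e = w $ 1" "h w \<bullet> f = w $ 2" for w
    using assms by (simp_all add: h_def orthonormal_def inner_simps inner_commute[of f e])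
  have "h v \<bullet> h w = v \<bullet> w" for v w
    by (subst orthonormal_inner[OF assms]) (simp only: h, simp only: inner_real2)
  then have orth: "orthogonal_transformation h"
    using lin by (simp add: orthogonal_transformation_def)
  define K where "K = cbox (vector [- p, - q]) (vector [p', q'] :: real ^ 2)"
  have im: "oblong 0 e f p p' q q' = h ` K"
  proof (intro set_eqI iffI)
    fix z assume z: "z \<in> oblong 0 e f p p' q q'"
    define w where "w = (vector [z \<bullet> e, z \<bullet> f] :: real ^ 2)"
    have "z = h w" using orthonormal_expansion[OF assms, of z] by (simp add: h_def w_def)
    moreover have "w \<in> K" using z
      by (simp add: w_def K_def mem_box_cart forall_2 oblong_def)
    ultimately show "z \<in> h ` K" by blast
  next
    fix z assume "z \<in> h ` K"
    then show "z \<in> oblong 0 e f p p' q q'"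
      by (auto simp: h K_def mem_box_cart forall_2 oblong_def)
  qed
  show "compact (oblong 0 e f p p' q q')"
    unfolding im K_def by (intro compact_continuous_image linear_continuous_on lin[unfolded linear_conv_bounded_linear] compact_cbox)
  have m: "measure lebesgue (oblong 0 e f p p' q q') = measure lebesgue K"
    unfolding im by (intro measure_orthogonal_image orth) (simp add: K_def)
  assume "0 \<le> p + p'" "0 \<le> q + q'"
  then have "K \<noteq> {}"
    by (simp add: K_def interval_ne_empty_cart forall_2)
  then show "measure lebesgue (oblong 0 e f p p' q q') = (p + p') * (q + q')"
    unfolding m by (simp add: K_def content_cbox_cart UNIV_2 add.commute)
qed

lemma oblong_translate: "oblong m e f p p' q q' = (+) m ` oblong 0 e f p p' q q'"
proof (intro set_eqI iffI)
  fix z assume "z \<in> oblong m e f p p' q q'"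
  then have "z - m \<in> oblong 0 e f p p' q q'" by (simp add: oblong_def)
  then show "z \<in> (+) m ` oblong 0 e f p p' q q'" by (intro image_eqI[of _ _ "z - m"]) auto
qed (auto simp: oblong_def)

lemma compact_oblong:
  assumes "orthonormal e f"
  shows "compact (oblong m e f p p' q q')"
  using oblong_origin(1)[OF assms] by (simp add: oblong_translate[of m] compact_translation)

lemma measure_oblong:
  assumes "orthonormal e f" "0 \<le> p + p'" "0 \<le> q + q'"
  shows "measure lebesgue (oblong m e f p p' q q') = (p + p') * (q + q')"
  using oblong_origin(2)[OF assms] by (simp add: oblong_translate[of m] measure_translation)

lemma oblong_swap: "oblong m e f p p' q q' = oblong m f e q q' p p'"
  by (auto simp: oblong_def)

section \<open>Measure comparison, and the area of a centred square in a quadrant\<close>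

lemma closed_quadrant: "closed (quadrant m e f)"
  unfolding quadrant_def by (intro closed_Collect_conj closed_Collect_le continuous_intros)

lemma open_oblong_interior:
  "open {z. - p < (z - m) \<bullet> e \<and> (z - m) \<bullet> e < p' \<and> - q < (z - m) \<bullet> f \<and> (z - m) \<bullet> f < q'}"
  by (intro open_Collect_conj open_Collect_less continuous_intros)

text \<open>The two closed halves overlap only in a line, which is negligible.\<close>

lemma measure_split_halfplane:
  fixes e :: "real ^ 2"
  assumes "compact S" "e \<noteq> 0"
  shows "measure lebesgue S =
    measure lebesgue (S \<inter> {z. 0 \<le> z \<bullet> e}) + measure lebesgue (S \<inter> {z. 0 \<le> z \<bullet> - e})"
proof -
  let ?P = "S \<inter> {z. 0 \<le> z \<bullet> e}" and ?N = "S \<inter> {z. 0 \<le> z \<bullet> - e}"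
  have "closed {z. 0 \<le> z \<bullet> e}" "closed {z. 0 \<le> z \<bullet> - e}"
    by (intro closed_Collect_le continuous_intros)+
  then have m: "?P \<in> lmeasurable" "?N \<in> lmeasurable"
    using assms(1) by (simp_all add: lmeasurable_compact compact_Int_closed)
  have "?P \<inter> ?N \<subseteq> {z. e \<bullet> z = 0}" by (auto simp: inner_commute)
  then have "negligible (?P \<inter> ?N)"
    using negligible_hyperplane[of e 0] assms(2) negligible_subset by blast
  moreover have "S = ?P \<union> ?N" by auto
  ultimately show ?thesis
    using measure_Un3[OF m] by (simp add: negligible_imp_measure0)
qed

text \<open>The open set \<open>U - X\<close> is nonempty, hence not negligible, and it lies in
  \<open>Y - X\<close>.\<close>

lemma measure_compact_strict_mono:
  fixes X Y U :: "(real ^ 2) set"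
  assumes "compact X" "compact Y" "X \<subseteq> Y" "open U" "U \<subseteq> Y" "y \<in> U" "y \<notin> X"
  shows "measure lebesgue X < measure lebesgue Y"
proof -
  have lm: "X \<in> lmeasurable" "Y \<in> lmeasurable"
    using assms(1,2) by (simp_all add: lmeasurable_compact)
  have "open (U - X)" "U - X \<noteq> {}"
    using assms by (auto simp: open_Diff compact_imp_closed)
  then have "\<not> negligible (U - X)"
    using open_not_negligible by blast
  then have "\<not> negligible (Y - X)"
    using negligible_subset[of "Y - X" "U - X"] assms(5) by blast
  then have "measure lebesgue (Y - X) \<noteq> 0"
    using lm negligible_iff_measure by blast
  moreover have "measure lebesgue (Y - X) = measure lebesgue Y - measure lebesgue X"
    using lm assms(3) by (simp add: measurable_measure_Diff fmeasurableD)
  ultimately show ?thesis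
    using measure_nonneg[of lebesgue "Y - X"] by linarith
qed

text \<open>The quarter turn \<open>\<rho>\<close> with \<open>e\<close> to \<open>f\<close> and
  \<open>f\<close> to \<open>- e\<close> moves one quadrant onto the other. It preserves area and
  every square centred at 0, however tilted.\<close>

lemma quarter_turn_quadrant:
  assumes uv: "orthonormal u v" and ef: "orthonormal e f"
  shows "measure lebesgue (oblong 0 u v r r r r \<inter> quadrant 0 f (- e)) =
    measure lebesgue (oblong 0 u v r r r r \<inter> quadrant 0 e f)"
proof -
  define \<rho> where "\<rho> w = (w \<bullet> e) *\<^sub>R f - (w \<bullet> f) *\<^sub>R e" for w
  have lin: "linear \<rho>"
    by (rule linearI) (simp_all add: \<rho>_def algebra_simps inner_simps)
  have \<rho>: "\<rho> w \<bullet> e = - (w \<bullet> f)" "\<rho> w \<bullet> f = w \<bullet> e" for w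
    using ef by (simp_all add: \<rho>_def orthonormal_def inner_simps inner_commute[of f e])
  have "\<rho> v \<bullet> \<rho> w = v \<bullet> w" for v w
    by (subst (1 2) orthonormal_inner[OF ef]) (simp add: \<rho>)
  then have orth: "orthogonal_transformation \<rho>"
    using lin by (simp add: orthogonal_transformation_def)
  \<comment> \<open>Two quarter turns make a half turn, so \<open>- \<rho>\<close> is the inverse of
    \<open>\<rho>\<close>.\<close>
  have \<rho>\<rho>: "\<rho> (- \<rho> w) = w" for w
    using orthonormal_expansion[OF ef, of w] by (simp add: \<rho>_def[of "- \<rho> w"] \<rho> add.commute)
  have e1: "e $ 1 * e $ 1 + e $ 2 * e $ 2 = 1"
    using ef by (simp add: orthonormal_def inner_real2)
  have c: "\<rho> w $ 1 = (w $ 1 * e $ 1 + w $ 2 * e $ 2) * f $ 1 - (w $ 1 * f $ 1 + w $ 2 * f $ 2) * e $ 1"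
    "\<rho> w $ 2 = (w $ 1 * e $ 1 + w $ 2 * e $ 2) * f $ 2 - (w $ 1 * f $ 1 + w $ 2 * f $ 2) * e $ 2" for w
    by (simp_all add: \<rho>_def inner_real2)
  \<comment> \<open>In standard coordinates a quarter turn is one of two fixed maps, whatever the
    frame. Hence in the frame \<open>u\<close>, \<open>v\<close> it also exchanges the coordinates
    up to sign.\<close>
  have turn: "(\<rho> w $ 1 = - w $ 2 \<and> \<rho> w $ 2 = w $ 1) \<or> (\<rho> w $ 1 = w $ 2 \<and> \<rho> w $ 2 = - w $ 1)" for w
    using orthonormal_orient[OF ef]
  proof (elim disjE conjE, goal_cases)
    case 1
    have "\<rho> w $ 1 = - w $ 2 * (e $ 1 * e $ 1 + e $ 2 * e $ 2)"
      "\<rho> w $ 2 = w $ 1 * (e $ 1 * e $ 1 + e $ 2 * e $ 2)"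
      unfolding c 1 by (simp_all add: algebra_simps)
    then show ?case by (simp add: e1)
  next
    case 2
    have "\<rho> w $ 1 = w $ 2 * (e $ 1 * e $ 1 + e $ 2 * e $ 2)"
      "\<rho> w $ 2 = - w $ 1 * (e $ 1 * e $ 1 + e $ 2 * e $ 2)"
      unfolding c 2 by (simp_all add: algebra_simps)
    then show ?case by (simp add: e1)
  qed
  have uv': "(\<rho> w \<bullet> u = w \<bullet> v \<and> \<rho> w \<bullet> v = - (w \<bullet> u)) \<or>
     (\<rho> w \<bullet> u = - (w \<bullet> v) \<and> \<rho> w \<bullet> v = w \<bullet> u)" for w
    using orthonormal_orient[OF uv] turn[of w] by (auto simp: inner_real2)
  let ?Q = "oblong 0 u v r r r r"
  have Q: "\<rho> w \<in> ?Q" "- w \<in> ?Q" if "w \<in> ?Q" for w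
    using that uv'[of w] by (auto simp: oblong_def)
  have "?Q \<inter> quadrant 0 f (- e) = \<rho> ` (?Q \<inter> quadrant 0 e f)"
  proof (intro set_eqI iffI)
    fix z assume z: "z \<in> ?Q \<inter> quadrant 0 f (- e)"
    then have "- \<rho> z \<in> ?Q \<inter> quadrant 0 e f"
      using Q by (auto simp: quadrant_def \<rho>)
    then show "z \<in> \<rho> ` (?Q \<inter> quadrant 0 e f)"
      using \<rho>\<rho>[of z] by force
  next
    fix z assume "z \<in> \<rho> ` (?Q \<inter> quadrant 0 e f)"
    then show "z \<in> ?Q \<inter> quadrant 0 f (- e)"
      using Q by (auto simp: quadrant_def \<rho>)
  qed
  moreover have "?Q \<inter> quadrant 0 e f \<in> lmeasurable"
    by (simp add: lmeasurable_compact compact_Int_closed compact_oblong[OF uv] closed_quadrant)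
  ultimately show ?thesis
    by (simp add: measure_orthogonal_image orth)
qed

text \<open>Halfplanes cut the square of side \<open>2 * r\<close> into four quadrant pieces, and
  quarter turns show that these have equal area, even if the square is tilted against the
  quadrant.\<close>

lemma measure_square_quadrant:
  assumes uv: "orthonormal u v" and ef: "orthonormal e f" and r: "0 \<le> r"
  shows "measure lebesgue (oblong m u v r r r r \<inter> quadrant m e f) = r\<^sup>2"
proof -
  let ?Q = "oblong 0 u v r r r r"
  let ?H = "\<lambda>e. {z :: real ^ 2. 0 \<le> z \<bullet> e}"
  let ?M = "\<lambda>e f. measure lebesgue (?Q \<inter> quadrant 0 e f)"
  note on = orthonormal_swap orthonormal_minus orthonormal_minus_right
  have nz: "e \<noteq> 0" "f \<noteq> 0" using ef by (auto simp: orthonormal_def)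
  have cq: "compact ?Q" using compact_oblong[OF uv] .
  have ch: "compact (?Q \<inter> ?H d)" for d
    by (intro compact_Int_closed cq closed_Collect_le continuous_intros)
  have quad: "?Q \<inter> ?H d \<inter> ?H d' = ?Q \<inter> quadrant 0 d d'" for d d'
    by (auto simp: quadrant_def)
  have sym: "?M d d' = ?M d' d" for d d'
    by (rule arg_cong[where f = "measure lebesgue"]) (auto simp: quadrant_def)
  have "(r + r) * (r + r) = measure lebesgue ?Q"
    using measure_oblong[OF uv, of r r r r 0] r by simp
  also have "\<dots> = ?M e f + ?M e (- f) + (?M (- e) f + ?M (- e) (- f))"
    using measure_split_halfplane[OF cq nz(1)] measure_split_halfplane[OF ch nz(2), of e]
      measure_split_halfplane[OF ch nz(2), of "- e"]
    by (simp only: quad)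
  also have "?M e (- f) = ?M e f"
    using quarter_turn_quadrant[OF uv, of "- f" e r] sym ef on by (metis minus_minus)
  also have "?M (- e) f = ?M e f"
    using quarter_turn_quadrant[OF uv ef, of r] sym by simp
  also have "?M (- e) (- f) = ?M e f"
    using quarter_turn_quadrant[OF uv, of f "- e" r] quarter_turn_quadrant[OF uv ef, of r] ef on
    by metis
  finally have "?M e f = r\<^sup>2" by (simp add: power2_eq_square)
  moreover have "oblong m u v r r r r \<inter> quadrant m e f = (+) m ` (?Q \<inter> quadrant 0 e f)"
  proof (intro set_eqI iffI)
    fix z assume "z \<in> oblong m u v r r r r \<inter> quadrant m e f"
    then have "z - m \<in> ?Q \<inter> quadrant 0 e f" by (simp add: oblong_def quadrant_def)
    then show "z \<in> (+) m ` (?Q \<inter> quadrant 0 e f)" by (intro image_eqI[of _ _ "z - m"]) auto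
  qed (auto simp: oblong_def quadrant_def)
  ultimately show ?thesis by (simp add: measure_translation)
qed

section \<open>Rectangles, laptops and tables in frame coordinates\<close>

lemma rectangle_frame:
  assumes "is_rectangle A B C D"
  defines "e \<equiv> (1 / dist A B) *\<^sub>R (B - A)" and "f \<equiv> (1 / dist A D) *\<^sub>R (D - A)"
  shows "orthonormal e f"
    and "B = A + dist A B *\<^sub>R e" "D = A + dist A D *\<^sub>R f"
    and "C = A + dist A B *\<^sub>R e + dist A D *\<^sub>R f"
    and "convex hull {A, B, C, D} = oblong A e f 0 (dist A B) 0 (dist A D)"
proof -
  define a b where "a = dist A B" and "b = dist A D"
  have R: "A \<noteq> B" "A \<noteq> D" "(B - A) \<bullet> (D - A) = 0" and C: "C = B + D - A"
    using assms(1) by (auto simp: is_rectangle_def orthogonal_def algebra_simps)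
  have ab: "a > 0" "b > 0" using R by (simp_all add: a_def b_def)
  have "(B - A) \<bullet> (B - A) = a * a" "(D - A) \<bullet> (D - A) = b * b"
    by (simp_all add: a_def b_def dist_norm norm_minus_commute power2_norm_eq_inner[symmetric] power2_eq_square)
  then show ef: "orthonormal e f"
    using R(3) ab unfolding orthonormal_def e_def f_def a_def[symmetric] b_def[symmetric] by simp
  then have ips: "e \<bullet> e = 1" "f \<bullet> f = 1" "e \<bullet> f = 0" "f \<bullet> e = 0"
    by (auto simp: orthonormal_def inner_commute)
  show B: "B = A + dist A B *\<^sub>R e" and D: "D = A + dist A D *\<^sub>R f"
    using ab by (simp_all add: e_def f_def a_def b_def)
  then show C': "C = A + dist A B *\<^sub>R e + dist A D *\<^sub>R f"
    using B unfolding C by (simp add: algebra_simps)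
  let ?O = "oblong A e f 0 a 0 b"
  have "convex ?O"
    unfolding oblong_def Collect_conj_eq inner_diff_left
    by (intro convex_Int) (simp_all add: algebra_simps inner_commute[of _ e] inner_commute[of _ f]
        convex_halfspace_le convex_halfspace_ge)
  moreover have "{A, B, C, D} \<subseteq> ?O"
    using ab unfolding oblong_def C' a_def[symmetric] b_def[symmetric]
    by (subst B, subst D) (simp add: inner_simps ips a_def b_def)
  ultimately have "convex hull {A, B, C, D} \<subseteq> ?O"
    by (rule hull_minimal[rotated])
  moreover have "?O \<subseteq> convex hull {A, B, C, D}"
  proof
    fix z assume z: "z \<in> ?O"
    define x y where "x = ((z - A) \<bullet> e) / a" and "y = ((z - A) \<bullet> f) / b"
    have xy: "0 \<le> x" "x \<le> 1" "0 \<le> y" "y \<le> 1"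
      using z ab by (auto simp: x_def y_def oblong_def divide_simps)
    let ?H = "convex hull {A, B, C, D}"
    have V: "A \<in> ?H" "B \<in> ?H" "C \<in> ?H" "D \<in> ?H" by (auto intro: hull_inc)
    \<comment> \<open>Bilinear interpolation of the vertices: weight \<open>x\<close> along both
      sides parallel to \<open>e\<close>, then weight \<open>y\<close> between the two points
      obtained.\<close>
    have "(1 - y) *\<^sub>R ((1 - x) *\<^sub>R A + x *\<^sub>R B) + y *\<^sub>R ((1 - x) *\<^sub>R D + x *\<^sub>R C) \<in> ?H"
      using xy V by (intro convexD convex_convex_hull) auto
    also have "(1 - y) *\<^sub>R ((1 - x) *\<^sub>R A + x *\<^sub>R B) + y *\<^sub>R ((1 - x) *\<^sub>R D + x *\<^sub>R C) =
        A + x *\<^sub>R (B - A) + y *\<^sub>R (D - A)"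
      by (simp add: C algebra_simps)
    also have "\<dots> = A + ((z - A) \<bullet> e) *\<^sub>R e + ((z - A) \<bullet> f) *\<^sub>R f"
      using ab by (simp add: x_def y_def e_def f_def a_def b_def)
    also have "\<dots> = z" using orthonormal_expansion[OF ef, of "z - A"] by (simp add: add.assoc)
    finally show "z \<in> ?H" .
  qed
  ultimately show "convex hull {A, B, C, D} = oblong A e f 0 (dist A B) 0 (dist A D)"
    unfolding a_def b_def by blast
qed

lemma rectangle_of_frame:
  assumes ef: "orthonormal e f" and ab: "a > 0" "b > 0"
  shows "is_rectangle A (A + a *\<^sub>R e) (A + a *\<^sub>R e + b *\<^sub>R f) (A + b *\<^sub>R f)"
    and "dist A (A + a *\<^sub>R e) = a" "dist A (A + b *\<^sub>R f) = b"
    and "convex hull {A, A + a *\<^sub>R e, A + a *\<^sub>R e + b *\<^sub>R f, A + b *\<^sub>R f} = oblong A e f 0 a 0 b"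
proof -
  have n: "norm e = 1" "norm f = 1" "e \<noteq> 0" "f \<noteq> 0"
    using ef by (auto simp: orthonormal_def norm_eq_sqrt_inner)
  show r: "is_rectangle A (A + a *\<^sub>R e) (A + a *\<^sub>R e + b *\<^sub>R f) (A + b *\<^sub>R f)"
    using ef ab n by (simp add: is_rectangle_def orthonormal_def orthogonal_def)
  show d: "dist A (A + a *\<^sub>R e) = a" "dist A (A + b *\<^sub>R f) = b"
    using n ab by (simp_all add: dist_norm)
  show "convex hull {A, A + a *\<^sub>R e, A + a *\<^sub>R e + b *\<^sub>R f, A + b *\<^sub>R f} = oblong A e f 0 a 0 b"
    using rectangle_frame(5)[OF r] ab unfolding d by simp
qed

abbreviation laptop :: "real \<Rightarrow> real ^ 2 \<Rightarrow> real ^ 2 \<Rightarrow> real ^ 2 \<Rightarrow> (real ^ 2) set"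
  where "laptop L m u v \<equiv> oblong m u v (1/2) (1/2) (L/2) (L/2)"

lemma laptop_shift:
  assumes "orthonormal u v" "m = A + (1/2) *\<^sub>R u + (L/2) *\<^sub>R v"
  shows "oblong A u v 0 1 0 L = laptop L m u v"
proof -
  have "(z - m) \<bullet> u = (z - A) \<bullet> u - 1/2" "(z - m) \<bullet> v = (z - A) \<bullet> v - L/2" for z
    using assms by (simp_all add: inner_simps orthonormal_def inner_commute[of v u])
  then show ?thesis by (auto simp: oblong_def)
qed

text \<open>The only centre of symmetry of a solid rectangle is the midpoint of its diagonal from
  \<open>A\<close>, so for given \<open>u\<close> and \<open>v\<close> the points \<open>m\<close>
  and \<open>A\<close> determine each other by
  \<open>m = A + (1/2) *\<^sub>R u + (L/2) *\<^sub>R v\<close>.\<close>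

lemma centered_solid_rectangle_iff:
  assumes "L > 0"
  shows "is_solid_rectangle 1 L R \<and> is_center_of_symmetry m R \<longleftrightarrow>
    (\<exists>u v. orthonormal u v \<and> R = laptop L m u v)" (is "?l \<longleftrightarrow> ?r")
proof
  assume ?l
  then obtain A B C D where r: "is_rectangle A B C D" and d: "dist A B = 1" "dist A D = L"
    and R: "R = convex hull {A, B, C, D}" and c: "is_center_of_symmetry m R"
    unfolding is_solid_rectangle_def by blast
  define u v where "u = (1 / dist A B) *\<^sub>R (B - A)" and "v = (1 / dist A D) *\<^sub>R (D - A)"
  note fr = rectangle_frame[OF r, folded u_def v_def, unfolded d]
  have "m = midpoint A C" using center_of_symmetry_rectangle(1)[OF r] c R by simp
  then have "m = A + (1/2) *\<^sub>R u + (L/2) *\<^sub>R v"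
    unfolding fr(4) by (simp add: midpoint_def vec_eq_iff field_simps)
  then show ?r using laptop_shift[OF fr(1)] fr(1,5) R by metis
next
  assume ?r
  then obtain u v where uv: "orthonormal u v" and R: "R = laptop L m u v" by blast
  define A where "A = m - (1/2) *\<^sub>R u - (L/2) *\<^sub>R v"
  note r = rectangle_of_frame[OF uv zero_less_one assms, of A]
  have R': "R = oblong A u v 0 1 0 L"
    using laptop_shift[OF uv, of m A L] R by (simp add: A_def)
  have "m = midpoint A (A + 1 *\<^sub>R u + L *\<^sub>R v)"
    by (simp add: A_def midpoint_def vec_eq_iff field_simps)
  then have "is_center_of_symmetry m R"
    using center_of_symmetry_rectangle(1)[OF r(1)] R' r(4) by simp
  moreover have "is_solid_rectangle 1 L R"
    unfolding is_solid_rectangle_def using r R' by metis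
  ultimately show ?l by simp
qed

text \<open>Changing the signs of \<open>e\<close> and \<open>f\<close> where necessary puts the
  nearer one of each pair of opposite sides at distance \<open>p\<close> or \<open>q\<close>. At a
  corner both of these distances vanish.\<close>

lemma table_frame:
  assumes r: "is_rectangle A B C D" and T: "T = convex hull {A, B, C, D}"
    and ab: "dist A B \<ge> 1" "dist A D \<ge> 1" and m: "m \<in> T"
  obtains e f p p' q q' where "orthonormal e f" "0 \<le> p" "p \<le> p'" "0 \<le> q" "q \<le> q'"
    "1 \<le> p + p'" "1 \<le> q + q'" "T = oblong m e f p p' q q'"
    "m \<in> {A, B, C, D} \<longleftrightarrow> p = 0 \<and> q = 0"
proof -
  define a b where "a = dist A B" and "b = dist A D"
  define e f where "e = (1 / dist A B) *\<^sub>R (B - A)" and "f = (1 / dist A D) *\<^sub>R (D - A)"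
  note fr = rectangle_frame[OF r, folded e_def f_def, folded a_def b_def]
  define x y where "x = (m - A) \<bullet> e" and "y = (m - A) \<bullet> f"
  have m_eq: "m = A + x *\<^sub>R e + y *\<^sub>R f"
    using orthonormal_expansion[OF fr(1), of "m - A"] by (simp add: x_def y_def add.assoc)
  have xy: "0 \<le> x" "x \<le> a" "0 \<le> y" "y \<le> b"
    using m unfolding T fr(5) by (simp_all add: oblong_def x_def y_def)
  have T': "T = oblong m e f x (a - x) y (b - y)"
    unfolding T fr(5) by (auto simp: oblong_def x_def y_def inner_simps)
  have ips: "e \<bullet> e = 1" "f \<bullet> f = 1" "e \<bullet> f = 0" "f \<bullet> e = 0"
    using fr(1) by (auto simp: orthonormal_def inner_commute)
  have corner: "m \<in> {A, B, C, D} \<longleftrightarrow> (x = 0 \<or> x = a) \<and> (y = 0 \<or> y = b)"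
  proof
    assume "m \<in> {A, B, C, D}"
    then show "(x = 0 \<or> x = a) \<and> (y = 0 \<or> y = b)"
      using fr(2-4) by (auto simp: x_def y_def ips inner_simps)
  next
    assume "(x = 0 \<or> x = a) \<and> (y = 0 \<or> y = b)"
    then show "m \<in> {A, B, C, D}"
      using m_eq fr(2-4) by auto
  qed
  \<comment> \<open>Reflecting the axis exchanges the distances \<open>x\<close> and
    \<open>a - x\<close>. As \<open>a \<ge> 1\<close>, the smaller one vanishes exactly when
    \<open>m\<close> lies on one of the two sides.\<close>
  have "\<exists>e'\<in>{e, - e}. \<exists>p p'. 0 \<le> p \<and> p \<le> p' \<and> 1 \<le> p + p' \<and> (p = 0 \<longleftrightarrow> x = 0 \<or> x = a) \<and>
    (\<forall>z. - p \<le> (z - m) \<bullet> e' \<and> (z - m) \<bullet> e' \<le> p' \<longleftrightarrow> - x \<le> (z - m) \<bullet> e \<and> (z - m) \<bullet> e \<le> a - x)"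
  proof (cases "x \<le> a - x")
    case True
    then have "x = 0 \<longleftrightarrow> x = 0 \<or> x = a" using xy ab a_def by auto
    then show ?thesis
      using True xy ab by (intro bexI[of _ e] exI[of _ x] exI[of _ "a - x"]) (auto simp: a_def)
  next
    case False
    then have "a - x = 0 \<longleftrightarrow> x = 0 \<or> x = a" using xy ab a_def by auto
    then show ?thesis
      using False xy ab by (intro bexI[of _ "- e"] exI[of _ "a - x"] exI[of _ x]) (auto simp: a_def)
  qed
  then obtain e' p p' where e': "e' \<in> {e, - e}" and p: "0 \<le> p" "p \<le> p'" "1 \<le> p + p'"
    "p = 0 \<longleftrightarrow> x = 0 \<or> x = a"
    "\<And>z. - p \<le> (z - m) \<bullet> e' \<and> (z - m) \<bullet> e' \<le> p' \<longleftrightarrow> - x \<le> (z - m) \<bullet> e \<and> (z - m) \<bullet> e \<le> a - x"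
    by blast
  have "\<exists>f'\<in>{f, - f}. \<exists>q q'. 0 \<le> q \<and> q \<le> q' \<and> 1 \<le> q + q' \<and> (q = 0 \<longleftrightarrow> y = 0 \<or> y = b) \<and>
    (\<forall>z. - q \<le> (z - m) \<bullet> f' \<and> (z - m) \<bullet> f' \<le> q' \<longleftrightarrow> - y \<le> (z - m) \<bullet> f \<and> (z - m) \<bullet> f \<le> b - y)"
  proof (cases "y \<le> b - y")
    case True
    then have "y = 0 \<longleftrightarrow> y = 0 \<or> y = b" using xy ab b_def by auto
    then show ?thesis
      using True xy ab by (intro bexI[of _ f] exI[of _ y] exI[of _ "b - y"]) (auto simp: b_def)
  next
    case False
    then have "b - y = 0 \<longleftrightarrow> y = 0 \<or> y = b" using xy ab b_def by auto
    then show ?thesis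
      using False xy ab by (intro bexI[of _ "- f"] exI[of _ "b - y"] exI[of _ y]) (auto simp: b_def)
  qed
  then obtain f' q q' where f': "f' \<in> {f, - f}" and q: "0 \<le> q" "q \<le> q'" "1 \<le> q + q'"
    "q = 0 \<longleftrightarrow> y = 0 \<or> y = b"
    "\<And>z. - q \<le> (z - m) \<bullet> f' \<and> (z - m) \<bullet> f' \<le> q' \<longleftrightarrow> - y \<le> (z - m) \<bullet> f \<and> (z - m) \<bullet> f \<le> b - y"
    by blast
  have "orthonormal e' f'"
    using fr(1) e' f' by (auto simp: orthonormal_def)
  moreover have "T = oblong m e' f' p p' q q'"
    unfolding T' oblong_def using p(5) q(5) by blast
  ultimately show thesis
    using that p(1-4) q(1-4) corner by blast
qed

section \<open>Lower bound for the footprint area\<close>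

lemma compact_laptop_Int:
  assumes "orthonormal e f" "orthonormal u v"
  shows "compact (laptop L m u v \<inter> oblong m e f p p' q q')"
  using assms by (simp add: compact_Int compact_oblong)

text \<open>The length of \<open>w\<close> is the same in every orthonormal frame, so a disc bound
  in one frame bounds each coordinate in another.\<close>

lemma orthonormal_abs_le:
  assumes "orthonormal e f" "(w \<bullet> e)\<^sup>2 + (w \<bullet> f)\<^sup>2 \<le> r\<^sup>2" "0 \<le> r" "orthonormal u v"
  shows "\<bar>w \<bullet> u\<bar> \<le> r" "\<bar>w \<bullet> v\<bar> \<le> r"
proof -
  have "(w \<bullet> u)\<^sup>2 + (w \<bullet> v)\<^sup>2 = (w \<bullet> e)\<^sup>2 + (w \<bullet> f)\<^sup>2"
    using orthonormal_inner[OF assms(1), of w w] orthonormal_inner[OF assms(4), of w w]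
    by (simp add: power2_eq_square)
  then have "(w \<bullet> u)\<^sup>2 \<le> r\<^sup>2" "(w \<bullet> v)\<^sup>2 \<le> r\<^sup>2"
    using assms(2) zero_le_power2[of "w \<bullet> u"] zero_le_power2[of "w \<bullet> v"] by linarith+
  then show "\<bar>w \<bullet> u\<bar> \<le> r" "\<bar>w \<bullet> v\<bar> \<le> r"
    using abs_le_square_iff[of _ r] assms(3) by auto
qed

lemma frame_point:
  assumes "orthonormal e f" and z: "z = m + x *\<^sub>R e + y *\<^sub>R f"
  shows "(z - m) \<bullet> e = x" "(z - m) \<bullet> f = y" "(z - m) \<bullet> u = x * (u \<bullet> e) + y * (u \<bullet> f)"
  using assms by (simp_all add: orthonormal_def inner_simps inner_commute[of f e]
      inner_commute[of e u] inner_commute[of f u])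

text \<open>No point of the unit square is farther from \<open>m\<close> than
  \<open>sqrt (1/2)\<close>, which is less than 71/100, so the table sides at \<open>p'\<close> and
  \<open>q'\<close> cut nothing off.\<close>

lemma square_quadrant_subset:
  assumes ef: "orthonormal e f" and uv: "orthonormal u v" and L: "1 \<le> L"
    and "0 \<le> p" "0 \<le> q" "71/100 \<le> p'" "71/100 \<le> q'"
  shows "laptop 1 m u v \<inter> quadrant m e f \<subseteq> laptop L m u v \<inter> oblong m e f p p' q q'"
proof
  fix z assume z: "z \<in> laptop 1 m u v \<inter> quadrant m e f"
  then have "\<bar>(z - m) \<bullet> u\<bar> \<le> 1/2" "\<bar>(z - m) \<bullet> v\<bar> \<le> 1/2"
    by (auto simp: oblong_def abs_le_iff)
  then have "((z - m) \<bullet> u)\<^sup>2 \<le> (1/2)\<^sup>2" "((z - m) \<bullet> v)\<^sup>2 \<le> (1/2)\<^sup>2"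
    using power_mono[of "\<bar>(z - m) \<bullet> u\<bar>" "1/2" 2] power_mono[of "\<bar>(z - m) \<bullet> v\<bar>" "1/2" 2] by auto
  then have "((z - m) \<bullet> u)\<^sup>2 + ((z - m) \<bullet> v)\<^sup>2 \<le> (71/100)\<^sup>2"
    by (simp add: power2_eq_square)
  from orthonormal_abs_le[OF uv this _ ef] show "z \<in> laptop L m u v \<inter> oblong m e f p p' q q'"
    using z assms(3-) by (auto simp: oblong_def quadrant_def)
qed

text \<open>Every laptop contains the disc of radius 1/2 about its midpoint. Two boxes in the part
  of this disc on the table have total area 0.2601.\<close>

lemma footprint_far:
  assumes ef: "orthonormal e f" and uv: "orthonormal u v" and L: "1 \<le> L"
    and p: "0 \<le> p" "1/2 \<le> p'" and q: "29/100 \<le> q" "1/2 \<le> q'"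
  shows "1/4 < measure lebesgue (laptop L m u v \<inter> oblong m e f p p' q q')"
proof -
  \<comment> \<open>The corners (3/10, 4/10) and (4/10, 3/10) lie on the circle of radius 1/2. The
    second box starts at 31/100, not at 3/10, which makes the boxes disjoint.\<close>
  let ?B = "oblong m e f 0 (3/10) (29/100) (4/10)" and ?C = "oblong m e f (-31/100) (4/10) (29/100) (3/10)"
  let ?Y = "laptop L m u v \<inter> oblong m e f p p' q q'"
  have lm: "?B \<in> lmeasurable" "?C \<in> lmeasurable" "?Y \<in> lmeasurable"
    by (intro lmeasurable_compact compact_oblong compact_laptop_Int ef uv)+
  have "?B \<union> ?C \<subseteq> ?Y"
  proof
    fix z assume z: "z \<in> ?B \<union> ?C"
    let ?x = "(z - m) \<bullet> e" and ?y = "(z - m) \<bullet> f"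
    have "(\<bar>?x\<bar> \<le> 3/10 \<and> \<bar>?y\<bar> \<le> 4/10) \<or> (\<bar>?x\<bar> \<le> 4/10 \<and> \<bar>?y\<bar> \<le> 3/10)"
      using z by (auto simp: oblong_def abs_le_iff)
    then have "?x\<^sup>2 + ?y\<^sup>2 \<le> (1/2)\<^sup>2"
    proof (elim disjE conjE)
      assume "\<bar>?x\<bar> \<le> 3/10" "\<bar>?y\<bar> \<le> 4/10"
      then show ?thesis
        using power_mono[of "\<bar>?x\<bar>" "3/10" 2] power_mono[of "\<bar>?y\<bar>" "4/10" 2]
        by (simp add: power2_eq_square)
    next
      assume "\<bar>?x\<bar> \<le> 4/10" "\<bar>?y\<bar> \<le> 3/10"
      then show ?thesis
        using power_mono[of "\<bar>?x\<bar>" "4/10" 2] power_mono[of "\<bar>?y\<bar>" "3/10" 2]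
        by (simp add: power2_eq_square)
    qed
    from orthonormal_abs_le[OF ef this _ uv] show "z \<in> ?Y"
      using z p q L by (auto simp: oblong_def)
  qed
  then have "measure lebesgue (?B \<union> ?C) \<le> measure lebesgue ?Y"
    using lm by (intro measure_mono_fmeasurable) auto
  moreover have disj: "?B \<inter> ?C = {}" by (auto simp: oblong_def)
  have "measure lebesgue (?B \<union> ?C) = measure lebesgue ?B + measure lebesgue ?C"
    by (simp only: measure_Un3[OF lm(1,2)] disj measure_empty diff_zero)
  moreover have "measure lebesgue ?B = 3/10 * (69/100)" "measure lebesgue ?C = 9/100 * (59/100)"
    by (simp_all add: measure_oblong[OF ef])
  ultimately show ?thesis by simp
qed

text \<open>One point \<open>z\<close> suffices for strictness: the strict inequalities cut out an
  open neighbourhood of \<open>z\<close> within the footprint.\<close>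

lemma measure_less_footprint:
  assumes "orthonormal e f" "orthonormal u v" "compact X" "X \<subseteq> laptop L m u v \<inter> oblong m e f p p' q q'"
    and z: "\<bar>(z - m) \<bullet> u\<bar> < 1/2" "\<bar>(z - m) \<bullet> v\<bar> < L/2"
      "- p < (z - m) \<bullet> e" "(z - m) \<bullet> e < p'" "- q < (z - m) \<bullet> f" "(z - m) \<bullet> f < q'"
    and "z \<notin> X"
  shows "measure lebesgue X < measure lebesgue (laptop L m u v \<inter> oblong m e f p p' q q')"
proof -
  let ?I = "\<lambda>e f p p' q q'. {z. - p < (z - m) \<bullet> e \<and> (z - m) \<bullet> e < p' \<and> - q < (z - m) \<bullet> f \<and> (z - m) \<bullet> f < q'}"
  let ?U = "?I u v (1/2) (1/2) (L/2) (L/2) \<inter> ?I e f p p' q q'"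
  have "open ?U" by (intro open_Int open_oblong_interior)
  moreover have "?U \<subseteq> laptop L m u v \<inter> oblong m e f p p' q q'"
    by (auto simp: oblong_def)
  moreover have "z \<in> ?U" using z by auto
  ultimately show ?thesis
    by (intro measure_compact_strict_mono[where U = ?U and y = z] compact_laptop_Int assms)
qed

lemma footprint_near:
  assumes ef: "orthonormal e f" and uv: "orthonormal u v" and L: "1 \<le> L"
    and p: "0 \<le> p" "p \<le> 29/100" "71/100 \<le> p'" and q: "0 \<le> q" "71/100 \<le> q'"
  shows "1/4 \<le> measure lebesgue (laptop L m u v \<inter> oblong m e f p p' q q')"
    and "0 < p \<Longrightarrow> 1/4 < measure lebesgue (laptop L m u v \<inter> oblong m e f p p' q q')"
proof -
  let ?X = "laptop 1 m u v \<inter> quadrant m e f"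
  let ?Y = "laptop L m u v \<inter> oblong m e f p p' q q'"
  have sub: "?X \<subseteq> ?Y" using square_quadrant_subset[OF ef uv L] p q by simp
  have c: "compact ?X" "compact ?Y"
    by (intro compact_Int_closed compact_oblong closed_quadrant compact_laptop_Int ef uv)+
  have X: "measure lebesgue ?X = 1/4"
    using measure_square_quadrant[OF uv ef, of "1/2" m] by (simp add: power2_eq_square)
  show "1/4 \<le> measure lebesgue ?Y"
    using sub c unfolding X[symmetric]
    by (intro measure_mono_fmeasurable) (auto simp: lmeasurable_compact fmeasurableD)
  assume pos: "0 < p"
  \<comment> \<open>This point is outside the quadrant but on the table, and within 4/10 of
    \<open>m\<close>. The second coordinate \<open>p/2\<close>, instead of 0, keeps it strictly
    inside even if \<open>q = 0\<close>.\<close>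
  define z where "z = m + (- (p/2)) *\<^sub>R e + (p/2) *\<^sub>R f"
  note z = frame_point[OF ef z_def]
  have "p/2 * (p/2) \<le> 29/200 * (29/200)" using p by (intro mult_mono) auto
  then have "((z - m) \<bullet> e)\<^sup>2 + ((z - m) \<bullet> f)\<^sup>2 \<le> (4/10)\<^sup>2"
    unfolding z(1,2) by (simp add: power2_eq_square)
  from orthonormal_abs_le[OF ef this _ uv]
  have "measure lebesgue ?X < measure lebesgue ?Y"
    using z(1,2) pos p q L by (intro measure_less_footprint[OF ef uv c(1) sub, of z]) (auto simp: quadrant_def)
  then show "1/4 < measure lebesgue ?Y" unfolding X .
qed

lemma footprint_lower_bound:
  assumes ef: "orthonormal e f" and uv: "orthonormal u v" and L: "1 \<le> L"
    and p: "0 \<le> p" "p \<le> p'" "1 \<le> p + p'" and q: "0 \<le> q" "q \<le> q'" "1 \<le> q + q'"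
  shows "1/4 \<le> measure lebesgue (laptop L m u v \<inter> oblong m e f p p' q q')" (is "1/4 \<le> ?\<mu>")
    and "measure lebesgue (laptop L m u v \<inter> oblong m e f p p' q q') = 1/4 \<Longrightarrow> p = 0 \<and> q = 0"
proof -
  have sw: "?\<mu> = measure lebesgue (laptop L m u v \<inter> oblong m f e q q' p p')"
    by (simp add: oblong_swap[of m e])
  note fe = orthonormal_swap[OF ef]
  have "1/4 \<le> ?\<mu> \<and> (?\<mu> = 1/4 \<longrightarrow> p = 0 \<and> q = 0)"
  \<comment> \<open>The threshold complements 71/100, a bound just above \<open>sqrt (1/2)\<close>:
    if \<open>p\<close> and \<open>q\<close> are both below it, the opposite sides are out of reach
    of the unit square. Exchanging \<open>e\<close> and \<open>f\<close> handles \<open>p\<close>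
    like \<open>q\<close>.\<close>
  proof (cases "29/100 \<le> p \<or> 29/100 \<le> q")
    case True
    then have "1/4 < ?\<mu>"
    proof
      assume "29/100 \<le> p"
      then show ?thesis unfolding sw using p q by (intro footprint_far fe uv L) auto
    next
      assume "29/100 \<le> q"
      then show ?thesis using p q by (intro footprint_far ef uv L) auto
    qed
    then show ?thesis by simp
  next
    case False
    then have *: "p \<le> 29/100" "71/100 \<le> p'" "q \<le> 29/100" "71/100 \<le> q'" using p q by auto
    have "1/4 \<le> ?\<mu>" "p > 0 \<Longrightarrow> 1/4 < ?\<mu>"
      using footprint_near[OF ef uv L p(1) *(1,2) q(1) *(4)] by simp_all
    moreover have "q > 0 \<Longrightarrow> 1/4 < ?\<mu>"
      unfolding sw using footprint_near[OF fe uv L q(1) *(3,4) p(1) *(2)] by simp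
    ultimately show ?thesis using p(1) q(1) by fastforce
  qed
  then show "1/4 \<le> ?\<mu>" "?\<mu> = 1/4 \<Longrightarrow> p = 0 \<and> q = 0" by simp_all
qed

section \<open>Corner triangles, and laptops centred at a corner\<close>

definition corner_triangle :: "real ^ 2 \<Rightarrow> real ^ 2 \<Rightarrow> real ^ 2 \<Rightarrow> real \<Rightarrow> (real ^ 2) set"
  where "corner_triangle m e f t = {z \<in> quadrant m e f. (z - m) \<bullet> e + (z - m) \<bullet> f \<le> t}"

text \<open>Dividing the frame coordinates by \<open>t\<close> gives the weights of the two vertices
  other than \<open>m\<close>.\<close>

lemma corner_triangle_hull:
  assumes ef: "orthonormal e f" and t: "0 < t"
  shows "convex hull {m, m + t *\<^sub>R e, m + t *\<^sub>R f} = corner_triangle m e f t"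
proof (intro set_eqI iffI)
  fix z assume "z \<in> convex hull {m, m + t *\<^sub>R e, m + t *\<^sub>R f}"
  then obtain \<alpha> \<beta> where ab: "0 \<le> \<alpha>" "0 \<le> \<beta>" "\<alpha> + \<beta> \<le> 1"
    and z: "z = m + (\<alpha> * t) *\<^sub>R e + (\<beta> * t) *\<^sub>R f"
    unfolding convex_hull_3_alt by auto
  have "\<alpha> * t + \<beta> * t \<le> 1 * t"
    unfolding distrib_right[symmetric] using ab t by (intro mult_right_mono) auto
  then show "z \<in> corner_triangle m e f t"
    using frame_point(1,2)[OF ef z] ab t by (simp add: corner_triangle_def quadrant_def)
next
  fix z assume z: "z \<in> corner_triangle m e f t"
  define x y where "x = (z - m) \<bullet> e" and "y = (z - m) \<bullet> f"
  have "z = m + (x / t) *\<^sub>R (m + t *\<^sub>R e - m) + (y / t) *\<^sub>R (m + t *\<^sub>R f - m)"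
    using orthonormal_expansion[OF ef, of "z - m"] t by (simp add: x_def y_def add.assoc)
  moreover have "0 \<le> x / t" "0 \<le> y / t" "x / t + y / t \<le> 1"
    using z t by (auto simp: corner_triangle_def quadrant_def x_def y_def divide_simps)
  ultimately show "z \<in> convex hull {m, m + t *\<^sub>R e, m + t *\<^sub>R f}"
    unfolding convex_hull_3_alt by blast
qed

lemma orthonormal_diagonal:
  assumes ef: "orthonormal e f"
  shows "orthonormal (sqrt (1/2) *\<^sub>R (e + f)) (sqrt (1/2) *\<^sub>R (e - f))"
proof -
  define s where "s = sqrt (1/2)"
  have "s * s = 1/2" by (simp add: s_def)
  then show ?thesis
    using ef unfolding s_def[symmetric]
    by (simp add: orthonormal_def inner_simps inner_commute[of f e] mult.assoc[symmetric])
qed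

text \<open>The area is compared, not computed: as \<open>t \<le> sqrt (1/2)\<close>, the triangle
  lies in the unit square about \<open>m\<close> with sides parallel to \<open>e + f\<close> and
  \<open>e - f\<close>, whose part in the quadrant has area 1/4.\<close>

lemma measure_corner_triangle_le:
  assumes ef: "orthonormal e f" and t: "0 < t" "2 * t\<^sup>2 \<le> 1"
  shows "measure lebesgue (corner_triangle m e f t) \<le> 1/4"
proof -
  define s where "s = sqrt (1/2)"
  have s: "0 < s" "s * s = 1/2" by (simp_all add: s_def)
  define u v where "u = s *\<^sub>R (e + f)" and "v = s *\<^sub>R (e - f)"
  have uv: "orthonormal u v"
    using orthonormal_diagonal[OF ef] by (simp only: u_def v_def s_def)
  have "t\<^sup>2 \<le> s\<^sup>2" using t s by (simp add: power2_eq_square)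
  then have ts: "t \<le> s" using s(1) power2_le_imp_le by fastforce
  have in_uv: "(z - m) \<bullet> u = s * ((z - m) \<bullet> e + (z - m) \<bullet> f)"
    "(z - m) \<bullet> v = s * ((z - m) \<bullet> e - (z - m) \<bullet> f)" for z
    by (simp_all add: u_def v_def inner_simps)
  have "corner_triangle m e f t \<subseteq> laptop 1 m u v \<inter> quadrant m e f"
  proof
    fix z assume z: "z \<in> corner_triangle m e f t"
    then have "\<bar>(z - m) \<bullet> e + (z - m) \<bullet> f\<bar> \<le> s" "\<bar>(z - m) \<bullet> e - (z - m) \<bullet> f\<bar> \<le> s"
      using ts by (auto simp: corner_triangle_def quadrant_def)
    then have "\<bar>(z - m) \<bullet> u\<bar> \<le> s * s" "\<bar>(z - m) \<bullet> v\<bar> \<le> s * s"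
      unfolding in_uv abs_mult using s(1) by (simp_all add: mult_left_mono)
    then show "z \<in> laptop 1 m u v \<inter> quadrant m e f"
      using z s(2) by (auto simp: corner_triangle_def oblong_def)
  qed
  moreover have "compact (corner_triangle m e f t)"
    unfolding corner_triangle_hull[OF ef t(1), symmetric]
    by (intro finite_imp_compact_convex_hull) simp
  ultimately have "measure lebesgue (corner_triangle m e f t) \<le>
      measure lebesgue (laptop 1 m u v \<inter> quadrant m e f)"
    by (intro measure_mono_fmeasurable)
      (auto simp: lmeasurable_compact compact_oblong[OF uv] compact_Int_closed closed_quadrant fmeasurableD)
  then show ?thesis
    using measure_square_quadrant[OF uv ef, of "1/2" m] by (simp add: power2_eq_square)
qed

text \<open>Here \<open>(a, b)\<close> stands for the direction of the side of length 1. The witness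
  lies near a vertex of the concentric unit square, with laptop coordinates \<open>s\<close>
  slightly below 1/2 in that direction and \<open>t\<close> slightly above 1/2 along the long
  side.\<close>

lemma tilt_witness_ordered:
  fixes a b L :: real
  assumes ab: "a\<^sup>2 + b\<^sup>2 = 1" "0 \<le> b" "b < a" and L: "1 < L"
  obtains x y where "0 < x" "x < 1" "0 < y" "y < 1" "0 < a * x + b * y" "a * x + b * y < 1/2"
    "1/2 < a * y - b * x" "a * y - b * x < L/2"
proof -
  \<comment> \<open>The first bound ensures \<open>t < L/2\<close>; the second keeps
    \<open>x\<close>, which equals \<open>(a - b)/2 - \<kappa> * (a + b)\<close>, positive.\<close>
  define \<kappa> where "\<kappa> = min ((L - 1) / 4) ((a - b) / 8)"
  have "a\<^sup>2 \<le> 1\<^sup>2" using ab(1) zero_le_power2[of b] unfolding one_power2 by linarith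
  then have a: "a \<le> 1" by (rule power2_le_imp_le) simp
  have \<kappa>: "0 < \<kappa>" "\<kappa> \<le> (L - 1) / 4" "\<kappa> \<le> (a - b) / 8"
    unfolding \<kappa>_def using ab L by simp (rule min.cobounded1 min.cobounded2)+
  define s t x y where "s = 1/2 - \<kappa>" and "t = 1/2 + \<kappa>" and "x = a * s - b * t" and "y = b * s + a * t"
  have st: "0 < s" "s < 1/2" "1/2 < t" "t < L/2" "s + t = 1"
    using \<kappa> ab a L by (simp_all add: s_def t_def)
  have "a * x + b * y = s * (a\<^sup>2 + b\<^sup>2)" "a * y - b * x = t * (a\<^sup>2 + b\<^sup>2)"
    by (simp_all add: x_def y_def power2_eq_square algebra_simps)
  then have st': "a * x + b * y = s" "a * y - b * x = t" using ab by simp_all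
  have "\<kappa> * (a + b) \<le> (a - b) / 8 * 2" using \<kappa> ab a by (intro mult_mono) auto
  then have "0 < x" using ab by (simp add: x_def s_def t_def algebra_simps)
  moreover have bt: "0 \<le> b * t" "0 \<le> b * s" "0 < a * t" using ab st by simp_all
  moreover have le: "a * s \<le> 1 * s" "a * t \<le> 1 * t" using a st by (intro mult_right_mono; simp)+
  moreover have "b * s < 1 * s" using ab a st by (intro mult_strict_right_mono) auto
  ultimately have "0 < x" "x < 1" "0 < y" "y < 1"
    unfolding x_def y_def using st by linarith+
  then show thesis using that[of x y] st st' by simp
qed

text \<open>If \<open>a\<close> and \<open>b\<close> have opposite signs, the long axis runs into
  the quadrant and one of its points serves. Otherwise a common sign is removed and the coordinates
  are exchanged if necessary, which leaves the ordered case.\<close>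

lemma tilt_witness:
  fixes a b L :: real
  assumes ab: "a\<^sup>2 + b\<^sup>2 = 1" "a \<noteq> b" and L: "1 < L"
  shows "\<exists>x y. 0 < x \<and> x < 1 \<and> 0 < y \<and> y < 1 \<and> \<bar>a * x + b * y\<bar> < 1/2 \<and>
    1/2 < \<bar>b * x - a * y\<bar> \<and> \<bar>b * x - a * y\<bar> < L/2"
proof (cases "a * b < 0")
  case True
  \<comment> \<open>Midway between 1/2 and \<open>min (L/2) 1\<close>: past the unit square, yet on
    the laptop and with both coordinates below 1.\<close>
  define t where "t = (1/2 + min (L/2) 1) / 2"
  have t: "1/2 < t" "t < L/2" "t < 1" using L by (auto simp: t_def)
  have "0 < a\<^sup>2" "0 < b\<^sup>2" using True by auto
  then have "a\<^sup>2 < 1" "b\<^sup>2 < 1" using ab(1) by linarith+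
  then have 1: "\<bar>a\<bar> < 1" "\<bar>b\<bar> < 1" by (simp_all add: abs_square_less_1)
  have nz: "a \<noteq> 0" "b \<noteq> 0" using True by auto
  have z: "a * (\<bar>b\<bar> * t) + b * (\<bar>a\<bar> * t) = 0"
    using True by (auto simp: abs_if mult_less_0_iff)
  have "b * (\<bar>b\<bar> * t) - a * (\<bar>a\<bar> * t) = t * (a\<^sup>2 + b\<^sup>2) \<or>
      b * (\<bar>b\<bar> * t) - a * (\<bar>a\<bar> * t) = - t * (a\<^sup>2 + b\<^sup>2)"
    using True by (auto simp: abs_if mult_less_0_iff power2_eq_square algebra_simps)
  then have "\<bar>b * (\<bar>b\<bar> * t) - a * (\<bar>a\<bar> * t)\<bar> = t"
    using ab t by auto
  moreover have "\<bar>a\<bar> * t < 1 * 1" "\<bar>b\<bar> * t < 1 * 1"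
    using 1 t by (intro mult_strict_mono; simp)+
  ultimately show ?thesis
    using z t nz by (intro exI[of _ "\<bar>b\<bar> * t"] exI[of _ "\<bar>a\<bar> * t"]) auto
next
  case False
  then obtain \<sigma> :: real where \<sigma>: "\<bar>\<sigma>\<bar> = 1" "a = \<sigma> * \<bar>a\<bar>" "b = \<sigma> * \<bar>b\<bar>"
    by (cases "0 \<le> a \<and> 0 \<le> b") (auto simp: not_less zero_le_mult_iff intro: that[of 1] that[of "- 1"])
  have abs: "\<bar>a * x + b * y\<bar> = \<bar>\<bar>a\<bar> * x + \<bar>b\<bar> * y\<bar>" "\<bar>b * x - a * y\<bar> = \<bar>\<bar>a\<bar> * y - \<bar>b\<bar> * x\<bar>" for x y
  proof -
    have "a * x + b * y = \<sigma> * (\<bar>a\<bar> * x + \<bar>b\<bar> * y)" "b * x - a * y = - \<sigma> * (\<bar>a\<bar> * y - \<bar>b\<bar> * x)"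
      using \<sigma>(2,3) by algebra+
    then show "\<bar>a * x + b * y\<bar> = \<bar>\<bar>a\<bar> * x + \<bar>b\<bar> * y\<bar>" "\<bar>b * x - a * y\<bar> = \<bar>\<bar>a\<bar> * y - \<bar>b\<bar> * x\<bar>"
      using \<sigma>(1) by (simp_all only: abs_mult abs_minus_cancel mult_1)
  qed
  have n: "\<bar>a\<bar>\<^sup>2 + \<bar>b\<bar>\<^sup>2 = 1" "\<bar>b\<bar>\<^sup>2 + \<bar>a\<bar>\<^sup>2 = 1" using ab by simp_all
  have "\<bar>a\<bar> \<noteq> \<bar>b\<bar>" using ab(2) \<sigma> by metis
  then consider "\<bar>b\<bar> < \<bar>a\<bar>" | "\<bar>a\<bar> < \<bar>b\<bar>" by linarith
  then show ?thesis
  proof cases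
    case 1
    obtain x y where *: "0 < x" "x < 1" "0 < y" "y < 1" "0 < \<bar>a\<bar> * x + \<bar>b\<bar> * y"
      "\<bar>a\<bar> * x + \<bar>b\<bar> * y < 1/2" "1/2 < \<bar>a\<bar> * y - \<bar>b\<bar> * x" "\<bar>a\<bar> * y - \<bar>b\<bar> * x < L/2"
      using tilt_witness_ordered[OF n(1) _ 1 L] by auto
    show ?thesis unfolding abs using * by (intro exI[of _ x] exI[of _ y]) auto
  next
    case 2
    obtain y x where *: "0 < y" "y < 1" "0 < x" "x < 1" "0 < \<bar>b\<bar> * y + \<bar>a\<bar> * x"
      "\<bar>b\<bar> * y + \<bar>a\<bar> * x < 1/2" "1/2 < \<bar>b\<bar> * x - \<bar>a\<bar> * y" "\<bar>b\<bar> * x - \<bar>a\<bar> * y < L/2"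
      using tilt_witness_ordered[OF n(2) _ 2 L] by auto
    show ?thesis unfolding abs using * by (intro exI[of _ y] exI[of _ x]) auto
  qed
qed

text \<open>The part of the concentric unit square in the quadrant already has area 1/4, and the
  tilt supplies an interior point of the footprint outside that square.\<close>

lemma footprint_tilted:
  assumes ef: "orthonormal e f" and uv: "orthonormal u v" and L: "1 < L"
    and p: "1 \<le> p'" "1 \<le> q'" and ne: "u \<bullet> e \<noteq> u \<bullet> f"
  shows "1/4 < measure lebesgue (laptop L m u v \<inter> oblong m e f 0 p' 0 q')"
proof -
  let ?X = "laptop 1 m u v \<inter> quadrant m e f"
  have "(u \<bullet> e)\<^sup>2 + (u \<bullet> f)\<^sup>2 = 1"
    using orthonormal_inner[OF ef, of u u] uv by (simp add: orthonormal_def power2_eq_square)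
  from tilt_witness[OF this ne L] obtain x y where xy: "0 < x" "x < 1" "0 < y" "y < 1"
    "\<bar>(u \<bullet> e) * x + (u \<bullet> f) * y\<bar> < 1/2" "1/2 < \<bar>(u \<bullet> f) * x - (u \<bullet> e) * y\<bar>"
    "\<bar>(u \<bullet> f) * x - (u \<bullet> e) * y\<bar> < L/2"
    by blast
  define z where "z = m + x *\<^sub>R e + y *\<^sub>R f"
  note z = frame_point[OF ef z_def]
  have zu: "\<bar>(z - m) \<bullet> u\<bar> < 1/2" using xy(5) unfolding z(3) by (simp add: mult.commute)
  \<comment> \<open>Up to sign \<open>v\<close> is the quarter turn of \<open>u\<close>; the
    absolute value absorbs the sign.\<close>
  have zv: "\<bar>(z - m) \<bullet> v\<bar> = \<bar>(u \<bullet> f) * x - (u \<bullet> e) * y\<bar>"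
    using orthonormal_orient_frame[OF ef uv] unfolding z(3) by (auto simp: algebra_simps)
  have "z \<notin> ?X"
  proof
    assume "z \<in> ?X"
    then have "\<bar>(z - m) \<bullet> v\<bar> \<le> 1/2" by (auto simp: oblong_def abs_le_iff)
    then show False using xy(6) zv by linarith
  qed
  moreover have "?X \<subseteq> laptop L m u v \<inter> oblong m e f 0 p' 0 q'"
    by (rule square_quadrant_subset[OF ef uv]) (use L p in auto)
  moreover have "compact ?X"
    by (intro compact_Int_closed compact_oblong closed_quadrant uv)
  ultimately have "measure lebesgue ?X < measure lebesgue (laptop L m u v \<inter> oblong m e f 0 p' 0 q')"
    using zu zv xy z(1,2) p by (intro measure_less_footprint[OF ef uv, of _ _ _ _ _ _ _ z]) auto
  then show ?thesis
    using measure_square_quadrant[OF uv ef, of "1/2" m] by (simp add: power2_eq_square)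
qed

text \<open>Both coordinates of \<open>u\<close> have absolute value \<open>sqrt (1/2)\<close>. In
  the quadrant the unit width therefore means \<open>x + y \<le> sqrt (1/2)\<close>, and this
  implies the constraint along the other side because \<open>L \<ge> 1\<close>.\<close>

lemma footprint_diagonal:
  assumes ef: "orthonormal e f" and uv: "orthonormal u v" and L: "1 \<le> L"
    and p: "1 \<le> p'" "1 \<le> q'" and eq: "u \<bullet> e = u \<bullet> f"
  shows "laptop L m u v \<inter> oblong m e f 0 p' 0 q' = corner_triangle m e f (sqrt (1/2))"
proof -
  define s where "s = sqrt (1/2)"
  have s: "0 < s" "s * s = 1/2" by (simp_all add: s_def)
  have "(u \<bullet> e)\<^sup>2 + (u \<bullet> f)\<^sup>2 = 1"
    using orthonormal_inner[OF ef, of u u] uv by (simp add: orthonormal_def power2_eq_square)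
  then have "(u \<bullet> e)\<^sup>2 = s\<^sup>2" using eq s by (simp add: power2_eq_square)
  then have k: "\<bar>u \<bullet> e\<bar> = s" using s(1) power2_eq_iff[of "u \<bullet> e" s] by auto
  have "s\<^sup>2 \<le> 1\<^sup>2" using s by (simp add: power2_eq_square)
  then have s1: "s \<le> 1" by (rule power2_le_imp_le) simp
  have "z \<in> laptop L m u v \<inter> oblong m e f 0 p' 0 q' \<longleftrightarrow> z \<in> corner_triangle m e f s" for z
  proof -
    define x y where "x = (z - m) \<bullet> e" and "y = (z - m) \<bullet> f"
    have "(z - m) \<bullet> u = (u \<bullet> e) * (x + y)"
      using orthonormal_inner[OF ef, of "z - m" u] eq by (simp add: x_def y_def algebra_simps)
    then have zu: "\<bar>(z - m) \<bullet> u\<bar> = s * \<bar>x + y\<bar>" using k by (simp add: abs_mult)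
    have "(z - m) \<bullet> v = x * (v \<bullet> e) + y * (v \<bullet> f)"
      using orthonormal_inner[OF ef, of "z - m" v] by (simp add: x_def y_def)
    then have "\<bar>(z - m) \<bullet> v\<bar> = \<bar>(u \<bullet> e) * (x - y)\<bar>"
      using orthonormal_orient_frame[OF ef uv] eq by (auto simp: algebra_simps)
    then have zv: "\<bar>(z - m) \<bullet> v\<bar> = s * \<bar>x - y\<bar>" using k by (simp add: abs_mult)
    have le: "s * r \<le> 1/2 \<longleftrightarrow> r \<le> s" for r
      unfolding s(2)[symmetric] using s(1) by simp
    have R: "z \<in> laptop L m u v \<longleftrightarrow> \<bar>x + y\<bar> \<le> s \<and> s * \<bar>x - y\<bar> \<le> L/2"
      unfolding le[of "\<bar>x + y\<bar>", symmetric] zu[symmetric] zv[symmetric]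
      by (simp only: oblong_def mem_Collect_eq abs_le_iff) linarith
    have T: "z \<in> oblong m e f 0 p' 0 q' \<longleftrightarrow> 0 \<le> x \<and> x \<le> p' \<and> 0 \<le> y \<and> y \<le> q'"
      by (simp add: oblong_def x_def y_def)
    have C: "z \<in> corner_triangle m e f s \<longleftrightarrow> 0 \<le> x \<and> 0 \<le> y \<and> x + y \<le> s"
      by (simp add: corner_triangle_def quadrant_def x_def y_def)
    have imp: "s * \<bar>x - y\<bar> \<le> L/2" if "\<bar>x - y\<bar> \<le> s"
      using le[of "\<bar>x - y\<bar>"] that L by linarith
    show ?thesis
      unfolding Int_iff R T C
    proof (intro iffI)
      assume "0 \<le> x \<and> 0 \<le> y \<and> x + y \<le> s"
      moreover from this have "\<bar>x - y\<bar> \<le> s" by linarith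
      ultimately show "(\<bar>x + y\<bar> \<le> s \<and> s * \<bar>x - y\<bar> \<le> L/2) \<and> 0 \<le> x \<and> x \<le> p' \<and> 0 \<le> y \<and> y \<le> q'"
        using imp p s1 by linarith
    qed linarith
  qed
  then show ?thesis unfolding s_def by blast
qed

section \<open>Isosceles right triangles as footprints\<close>

lemma hull_face_vertex:
  fixes g h :: "'a :: real_vector \<Rightarrow> real"
  assumes z: "z \<in> convex hull {P, Q, R}" and "linear g" "linear h"
    and g: "\<And>V. V \<in> {P, Q, R} \<Longrightarrow> c \<le> g V" and gz: "g z = c" and hz: "d < h z"
  shows "\<exists>V\<in>{P, Q, R}. g V = c \<and> d < h V"
proof -
  obtain \<alpha> \<beta> \<gamma> where w: "0 \<le> \<alpha>" "0 \<le> \<beta>" "0 \<le> \<gamma>" "\<alpha> + \<beta> + \<gamma> = 1"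
    and z: "z = \<alpha> *\<^sub>R P + \<beta> *\<^sub>R Q + \<gamma> *\<^sub>R R"
    using z unfolding convex_hull_3 by blast
  have gz': "\<alpha> * (g P - c) + \<beta> * (g Q - c) + \<gamma> * (g R - c) = g z - (\<alpha> + \<beta> + \<gamma>) * c"
    using \<open>linear g\<close> unfolding z by (simp add: linear_add linear_scale algebra_simps)
  have hz': "\<alpha> * (h P - d) + \<beta> * (h Q - d) + \<gamma> * (h R - d) = h z - (\<alpha> + \<beta> + \<gamma>) * d"
    using \<open>linear h\<close> unfolding z by (simp add: linear_add linear_scale algebra_simps)
  have nn: "0 \<le> \<alpha> * (g P - c)" "0 \<le> \<beta> * (g Q - c)" "0 \<le> \<gamma> * (g R - c)"
    using w g by simp_all
  have sum0: "\<alpha> * (g P - c) + \<beta> * (g Q - c) + \<gamma> * (g R - c) = 0"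
    using gz' gz w(4) by simp
  \<comment> \<open>Nonnegative terms with sum zero: only vertices on the face \<open>g = c\<close>
    carry weight, and the weighted mean of \<open>h\<close> over them exceeds
    \<open>d\<close>.\<close>
  have "\<alpha> * (g P - c) = 0 \<and> \<beta> * (g Q - c) = 0 \<and> \<gamma> * (g R - c) = 0"
    using sum0 nn by (intro conjI) linarith+
  moreover have "0 < \<alpha> * (h P - d) \<or> 0 < \<beta> * (h Q - d) \<or> 0 < \<gamma> * (h R - d)"
    using hz' hz w(4) by (simp, linarith)
  ultimately show ?thesis
    using w by (auto simp: zero_less_mult_iff)
qed

text \<open>The vertices are identified first: \<open>m\<close> and one more on each table side
  through \<open>m\<close>. The right angle must then be at \<open>m\<close>, and the unit width of
  the laptop bounds the legs.\<close>

lemma isosceles_corner_footprint: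
  assumes ef: "orthonormal e f" and uv: "orthonormal u v" and L: "1 \<le> L"
    and p: "1 \<le> p'" "1 \<le> q'"
    and tri: "is_isosceles_right_triangle (laptop L m u v \<inter> oblong m e f 0 p' 0 q')"
  shows "measure lebesgue (laptop L m u v \<inter> oblong m e f 0 p' 0 q') \<le> 1/4"
proof -
  let ?S = "laptop L m u v \<inter> oblong m e f 0 p' 0 q'"
  obtain P Q W where "P \<noteq> Q" and ort: "(Q - P) \<bullet> (W - P) = 0" and iso: "dist P Q = dist P W"
    and S: "?S = convex hull {P, Q, W}"
    using tri unfolding is_isosceles_right_triangle_def orthogonal_def by blast
  have ips: "e \<bullet> e = 1" "f \<bullet> f = 1" "e \<bullet> f = 0" "f \<bullet> e = 0"
    using ef by (auto simp: orthonormal_def inner_commute)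
  \<comment> \<open>A quarter disc of radius 1/2 supplies explicit footprint points:
    \<open>m\<close> itself and points on both table sides through it.\<close>
  have in_S: "m + x *\<^sub>R e + y *\<^sub>R f \<in> ?S" if "0 \<le> x" "0 \<le> y" "x\<^sup>2 + y\<^sup>2 \<le> (1/2)\<^sup>2" for x y
  proof -
    note z = frame_point[OF ef refl, of m x y]
    have "x\<^sup>2 \<le> (1/2)\<^sup>2" "y\<^sup>2 \<le> (1/2)\<^sup>2"
      using that(3) zero_le_power2[of x] zero_le_power2[of y] by linarith+
    then have xy: "x \<le> 1/2" "y \<le> 1/2" using power2_le_imp_le[of _ "1/2 :: real"] by auto
    define w where "w = m + x *\<^sub>R e + y *\<^sub>R f - m"
    have "\<bar>w \<bullet> u\<bar> \<le> 1/2" "\<bar>w \<bullet> v\<bar> \<le> 1/2"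
      using orthonormal_abs_le[OF ef _ _ uv, of w "1/2"] z(1,2) that by (simp_all add: w_def)
    then have "- (1/2) \<le> w \<bullet> u \<and> w \<bullet> u \<le> 1/2 \<and> - (L/2) \<le> w \<bullet> v \<and> w \<bullet> v \<le> L/2"
      using L by arith
    then show ?thesis
      using z(1,2) xy that p unfolding oblong_def w_def by simp
  qed
  have S_nonneg: "m \<bullet> e \<le> z \<bullet> e" "m \<bullet> f \<le> z \<bullet> f" if "z \<in> ?S" for z
    using that by (auto simp: oblong_def inner_simps)
  have V_S: "V \<in> ?S" if "V \<in> {P, Q, W}" for V
    unfolding S using that by (rule hull_inc)
  have lin: "linear (\<lambda>z. z \<bullet> w)" for w :: "real ^ 2"
    by (rule linearI) (simp_all add: inner_simps)
  have eqI: "V = m + ((V - m) \<bullet> e) *\<^sub>R e + ((V - m) \<bullet> f) *\<^sub>R f" for V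
    using orthonormal_expansion[OF ef, of "V - m"] by (simp add: add.assoc)
  \<comment> \<open>On the footprint the functional given by \<open>e + f\<close> is minimal at
    \<open>m\<close> alone, so \<open>m\<close> is a vertex. The second functional is zero, so its
    condition holds at every vertex.\<close>
  have "\<exists>V\<in>{P, Q, W}. V \<bullet> (e + f) = m \<bullet> (e + f) \<and> -1 < V \<bullet> 0"
    using in_S[of 0 0] V_S S_nonneg unfolding S
    by (intro hull_face_vertex[where z = m] lin) (auto simp: inner_simps intro!: add_mono)
  then obtain V where V: "V \<in> {P, Q, W}" "V \<bullet> (e + f) = m \<bullet> (e + f)" by blast
  then have "(V - m) \<bullet> e = 0" "(V - m) \<bullet> f = 0"
    using S_nonneg[OF V_S[OF V(1)]] by (simp_all add: inner_simps)
  then have mV: "m \<in> {P, Q, W}" using V(1) eqI[of V] by simp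
  \<comment> \<open>The footprint point \<open>m + (1/2) *\<^sub>R e\<close> forces a vertex on this
    table side beyond \<open>m\<close>.\<close>
  have "\<exists>V\<in>{P, Q, W}. V \<bullet> f = m \<bullet> f \<and> m \<bullet> e < V \<bullet> e"
    using in_S[of "1/2" 0] V_S S_nonneg unfolding S
    by (intro hull_face_vertex[where z = "m + (1/2) *\<^sub>R e"] lin) (auto simp: inner_simps ips)
  then obtain V where V: "V \<in> {P, Q, W}" "V \<bullet> f = m \<bullet> f" "m \<bullet> e < V \<bullet> e" by blast
  define t where "t = (V - m) \<bullet> e"
  have t: "0 < t" "m + t *\<^sub>R e \<in> {P, Q, W}"
    using V eqI[of V] by (simp_all add: t_def inner_simps)
  have "\<exists>V\<in>{P, Q, W}. V \<bullet> e = m \<bullet> e \<and> m \<bullet> f < V \<bullet> f"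
    using in_S[of 0 "1/2"] V_S S_nonneg unfolding S
    by (intro hull_face_vertex[where z = "m + (1/2) *\<^sub>R f"] lin) (auto simp: inner_simps ips)
  then obtain V where V: "V \<in> {P, Q, W}" "V \<bullet> e = m \<bullet> e" "m \<bullet> f < V \<bullet> f" by blast
  define r where "r = (V - m) \<bullet> f"
  have r: "0 < r" "m + r *\<^sub>R f \<in> {P, Q, W}"
    using V eqI[of V] by (simp_all add: r_def inner_simps)
  have ne: "m \<noteq> m + t *\<^sub>R e" "m \<noteq> m + r *\<^sub>R f" "m + t *\<^sub>R e \<noteq> m + r *\<^sub>R f"
  proof -
    have "(t *\<^sub>R e) \<bullet> e = t" "(r *\<^sub>R f) \<bullet> f = r" "(r *\<^sub>R f) \<bullet> e = 0"
      by (simp_all add: ips)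
    then have "t *\<^sub>R e \<noteq> 0" "r *\<^sub>R f \<noteq> 0" "t *\<^sub>R e \<noteq> r *\<^sub>R f"
      using t(1) r(1) by (metis inner_zero_left less_irrefl)+
    then show "m \<noteq> m + t *\<^sub>R e" "m \<noteq> m + r *\<^sub>R f" "m + t *\<^sub>R e \<noteq> m + r *\<^sub>R f" by auto
  qed
  have PQW: "{P, Q, W} = {m, m + t *\<^sub>R e, m + r *\<^sub>R f}"
    using mV t(2) r(2) ne by (elim insertE emptyE) auto
  \<comment> \<open>At either of the other two vertices the inner product of the edge vectors is the
    square of a leg, hence nonzero.\<close>
  have "P = m"
  proof (rule ccontr)
    assume "P \<noteq> m"
    then have "P = m + t *\<^sub>R e \<and> (Q = m \<and> W = m + r *\<^sub>R f \<or> W = m \<and> Q = m + r *\<^sub>R f) \<or>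
      P = m + r *\<^sub>R f \<and> (Q = m \<and> W = m + t *\<^sub>R e \<or> W = m \<and> Q = m + t *\<^sub>R e)"
      using mV t(2) r(2) ne by (elim insertE emptyE) auto
    then have "(Q - P) \<bullet> (W - P) = t * t \<or> (Q - P) \<bullet> (W - P) = r * r"
      by (auto simp: inner_simps ips algebra_simps)
    then show False using ort t(1) r(1) by auto
  qed
  then have "Q = m + t *\<^sub>R e \<and> W = m + r *\<^sub>R f \<or> W = m + t *\<^sub>R e \<and> Q = m + r *\<^sub>R f"
    using t(2) r(2) ne unfolding insert_iff empty_iff by metis
  moreover have "norm e = 1" "norm f = 1" using ips by (simp_all add: norm_eq_sqrt_inner)
  ultimately have "r = t" using iso \<open>P = m\<close> t(1) r(1) by (auto simp: dist_norm)
  then have S': "?S = corner_triangle m e f t"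
    unfolding S PQW using corner_triangle_hull[OF ef t(1)] by simp
  have "m + t *\<^sub>R e \<in> ?S" "m + t *\<^sub>R f \<in> ?S"
    using V_S t(2) r(2) \<open>r = t\<close> by blast+
  \<comment> \<open>Both outer vertices obey the width constraint of the laptop; adding the squares
    eliminates the direction of \<open>u\<close>.\<close>
  then have "\<bar>t * (u \<bullet> e)\<bar> \<le> 1/2" "\<bar>t * (u \<bullet> f)\<bar> \<le> 1/2"
    by (auto simp: oblong_def abs_le_iff inner_commute[of e u] inner_commute[of f u])
  then have "(t * (u \<bullet> e))\<^sup>2 \<le> (1/2)\<^sup>2" "(t * (u \<bullet> f))\<^sup>2 \<le> (1/2)\<^sup>2"
    using abs_le_square_iff[of _ "1/2 :: real"] by force+
  moreover have "(u \<bullet> e)\<^sup>2 + (u \<bullet> f)\<^sup>2 = 1"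
    using orthonormal_inner[OF ef, of u u] uv by (simp add: orthonormal_def power2_eq_square)
  then have "(t * (u \<bullet> e))\<^sup>2 + (t * (u \<bullet> f))\<^sup>2 = t\<^sup>2"
    by (simp add: power_mult_distrib distrib_left[symmetric])
  ultimately have "2 * t\<^sup>2 \<le> 1" by (simp add: power2_eq_square)
  then show ?thesis
    unfolding S' using measure_corner_triangle_le[OF ef t(1)] by simp
qed

lemma corner_triangle_isosceles:
  assumes ef: "orthonormal e f" and t: "0 < t"
  shows "is_isosceles_right_triangle (corner_triangle m e f t)"
proof -
  have n: "norm e = 1" "norm f = 1" "e \<noteq> 0" "e \<bullet> f = 0"
    using ef by (auto simp: orthonormal_def norm_eq_sqrt_inner)
  have "dist m (m + t *\<^sub>R e) = dist m (m + t *\<^sub>R f)"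
    using n t by (simp add: dist_norm)
  moreover have "orthogonal (m + t *\<^sub>R e - m) (m + t *\<^sub>R f - m)"
    using n by (simp add: orthogonal_def)
  moreover have "m \<noteq> m + t *\<^sub>R e" using n t by simp
  ultimately show ?thesis
    unfolding is_isosceles_right_triangle_def corner_triangle_hull[OF ef t, symmetric] by blast
qed

text \<open>The far table sides miss the square, so the footprint is its whole part in the quadrant,
  whose area does not depend on the tilt.\<close>

lemma footprint_square_corner:
  assumes ef: "orthonormal e f" and uv: "orthonormal u v" and p: "1 \<le> p'" "1 \<le> q'"
  shows "measure lebesgue (laptop 1 m u v \<inter> oblong m e f 0 p' 0 q') = 1/4"
proof -
  have "laptop 1 m u v \<inter> quadrant m e f \<subseteq> laptop 1 m u v \<inter> oblong m e f 0 p' 0 q'"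
    by (rule square_quadrant_subset[OF ef uv]) (use p in auto)
  moreover have "oblong m e f 0 p' 0 q' \<subseteq> quadrant m e f"
    by (auto simp: oblong_def quadrant_def)
  ultimately have "laptop 1 m u v \<inter> oblong m e f 0 p' 0 q' = laptop 1 m u v \<inter> quadrant m e f"
    by blast
  then show ?thesis
    using measure_square_quadrant[OF uv ef, of "1/2" m] by (simp add: power2_eq_square)
qed

section \<open>Minimal placements\<close>

lemma placement_iff:
  assumes "0 < L"
  shows "is_placement L T R \<longleftrightarrow> (\<exists>m\<in>T. \<exists>u v. orthonormal u v \<and> R = laptop L m u v)"
  using centered_solid_rectangle_iff[OF assms, of R] unfolding is_placement_def by blast

theorem theorem1:
  fixes A B C D :: "real ^ 2" and T :: "(real ^ 2) set" and L :: real
  assumes "is_rectangle A B C D"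
    and "T = convex hull {A, B, C, D}"
    and "min (dist A B) (dist A D) \<ge> 1"
    and "L \<ge> 1"
  shows "(\<exists>R. is_arg_min (footprint_area T) (is_placement L T) R) \<and>
    (L > 1 \<longrightarrow>
      (\<forall>R. is_placement L T R \<longrightarrow>
        (is_arg_min (footprint_area T) (is_placement L T) R \<longleftrightarrow>
          (\<exists>m\<in>{A, B, C, D}. is_center_of_symmetry m R) \<and>
          is_isosceles_right_triangle (R \<inter> T)))) \<and>
    (L = 1 \<longrightarrow>
      (\<forall>R. is_placement L T R \<longrightarrow>
        (is_arg_min (footprint_area T) (is_placement L T) R \<longleftrightarrow>
          (\<exists>m\<in>{A, B, C, D}. is_center_of_symmetry m R))))"
proof -
  let ?area = "footprint_area T" and ?P = "is_placement L T"
  have L: "0 < L" using assms(4) by simp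
  have ab: "dist A B \<ge> 1" "dist A D \<ge> 1" using assms(3) by simp_all
  note frame = table_frame[OF assms(1,2) ab]
  have corner_T: "{A, B, C, D} \<subseteq> T" unfolding assms(2) by (rule hull_subset)
  \<comment> \<open>An elimination rule: at a corner both near distances are zero, so the table
    becomes a box inside the quadrant.\<close>
  have corner: thesis
    if m: "m \<in> {A, B, C, D}" and ex: "\<And>e f p' q'. orthonormal e f \<Longrightarrow> 1 \<le> p' \<Longrightarrow> 1 \<le> q' \<Longrightarrow>
      T = oblong m e f 0 p' 0 q' \<Longrightarrow> thesis" for m thesis
  proof -
    have "m \<in> T" using m corner_T by blast
    then obtain e f p p' q q' where fr: "orthonormal e f" "0 \<le> p" "p \<le> p'" "0 \<le> q" "q \<le> q'"
      "1 \<le> p + p'" "1 \<le> q + q'" "T = oblong m e f p p' q q'"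
      "m \<in> {A, B, C, D} \<longleftrightarrow> p = 0 \<and> q = 0"
      by (rule frame)
    have "p = 0 \<and> q = 0" using m unfolding fr(9) .
    then have pq: "p = 0" "q = 0" by simp_all
    show thesis
      by (rule ex[OF fr(1)]) (use fr(6,7) fr(8)[unfolded pq] pq in simp_all)
  qed
  have lower: "1/4 \<le> ?area R" if "?P R" for R
  proof -
    obtain m u v where m: "m \<in> T" and uv: "orthonormal u v" and R: "R = laptop L m u v"
      using \<open>?P R\<close> unfolding placement_iff[OF L] by blast
    show ?thesis
      by (rule frame[OF m]) (simp only: footprint_area_def R, rule footprint_lower_bound(1)[OF _ uv assms(4)])
  qed
  have ex: "\<exists>R. ?P R \<and> ?area R = 1/4"
  proof (rule corner[of A])
    fix e f p' q' assume ef: "orthonormal e f" and p: "1 \<le> p'" "1 \<le> q'"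
      and T: "T = oblong A e f 0 p' 0 q'"
    \<comment> \<open>The side of length 1 is laid along the bisector of the corner, which makes the
      footprint a corner triangle with legs \<open>sqrt (1/2)\<close>. Its area is only bounded
      above; \<open>lower\<close> gives equality.\<close>
    define u v where "u = sqrt (1/2) *\<^sub>R (e + f)" and "v = sqrt (1/2) *\<^sub>R (e - f)"
    have uv: "orthonormal u v" using orthonormal_diagonal[OF ef] by (simp only: u_def v_def)
    have "u \<bullet> e = u \<bullet> f" using ef by (simp add: u_def orthonormal_def inner_simps inner_commute[of f e])
    from footprint_diagonal[OF ef uv assms(4) p this]
    have "?area (laptop L A u v) \<le> 1/4"
      unfolding footprint_area_def T using measure_corner_triangle_le[OF ef, of "sqrt (1/2)" A] by simp
    moreover have "?P (laptop L A u v)"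
      unfolding placement_iff[OF L] using uv corner_T by blast
    ultimately show ?thesis
      by (intro exI[of _ "laptop L A u v"] conjI antisym lower)
  qed simp
  \<comment> \<open>The lower bound 1/4 is attained, so being minimal means having this
    value.\<close>
  have arg_min: "is_arg_min ?area ?P R \<longleftrightarrow> ?area R = 1/4" if "?P R" for R
    using that ex lower unfolding is_arg_min_def by (metis antisym not_less)
  have minimal: "\<exists>m\<in>{A, B, C, D}. is_center_of_symmetry m R"
      "1 < L \<Longrightarrow> is_isosceles_right_triangle (R \<inter> T)"
    if "?P R" "?area R = 1/4" for R
  proof -
    obtain m u v where m: "m \<in> T" and uv: "orthonormal u v" and R: "R = laptop L m u v"
      using \<open>?P R\<close> unfolding placement_iff[OF L] by blast
    obtain e f p p' q q' where ef: "orthonormal e f" and fr: "0 \<le> p" "p \<le> p'" "0 \<le> q" "q \<le> q'"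
        "1 \<le> p + p'" "1 \<le> q + q'"
      and T: "T = oblong m e f p p' q q'" and c: "m \<in> {A, B, C, D} \<longleftrightarrow> p = 0 \<and> q = 0"
      by (rule frame[OF m])
    note p = fr(1,2,5) and q = fr(3,4,6)
    have area: "measure lebesgue (laptop L m u v \<inter> oblong m e f p p' q q') = 1/4"
      using that(2) by (simp only: footprint_area_def R T)
    have pq: "p = 0" "q = 0"
      using footprint_lower_bound(2)[OF ef uv assms(4) p q area] by simp_all
    have "is_center_of_symmetry m R"
      using centered_solid_rectangle_iff[OF L, of R m] uv R by blast
    then show "\<exists>m\<in>{A, B, C, D}. is_center_of_symmetry m R" using c pq by blast
    assume "1 < L"
    then have "u \<bullet> e = u \<bullet> f"
      using footprint_tilted[OF ef uv, of L p' q' m] area p q pq by fastforce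
    then have "R \<inter> T = corner_triangle m e f (sqrt (1/2))"
      unfolding R T pq using p q pq by (intro footprint_diagonal ef uv assms(4)) auto
    then show "is_isosceles_right_triangle (R \<inter> T)"
      using corner_triangle_isosceles[OF ef] by simp
  qed
  have triangle: "?area R = 1/4" if R: "?P R" and m: "m \<in> {A, B, C, D}" "is_center_of_symmetry m R"
    and tri: "is_isosceles_right_triangle (R \<inter> T)" for R m
  proof -
    have "is_solid_rectangle 1 L R" using \<open>?P R\<close> by (simp add: is_placement_def)
    then obtain u v where uv: "orthonormal u v" and R': "R = laptop L m u v"
      using m(2) centered_solid_rectangle_iff[OF L, of R m] by blast
    have "?area R \<le> 1/4"
    proof (rule corner[OF m(1)])
      fix e f p' q' assume "orthonormal e f" "1 \<le> p'" "1 \<le> q'" and T: "T = oblong m e f 0 p' 0 q'"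
      then show ?thesis
        using tri unfolding footprint_area_def R' T
        by (intro isosceles_corner_footprint uv assms(4))
    qed
    then show ?thesis using lower[OF R] by simp
  qed
  have square: "?area R = 1/4" if "?P R" "L = 1" and m: "m \<in> {A, B, C, D}" "is_center_of_symmetry m R" for R m
  proof -
    have "is_solid_rectangle 1 L R" using \<open>?P R\<close> by (simp add: is_placement_def)
    then obtain u v where uv: "orthonormal u v" and R': "R = laptop L m u v"
      using m(2) centered_solid_rectangle_iff[OF L, of R m] by blast
    show ?thesis
    proof (rule corner[OF m(1)])
      fix e f p' q' assume "orthonormal e f" "1 \<le> p'" "1 \<le> q'" and T: "T = oblong m e f 0 p' 0 q'"
      then show ?thesis
        using \<open>L = 1\<close> unfolding footprint_area_def R' T by (simp only: footprint_square_corner uv)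
    qed
  qed
  show ?thesis
  proof (intro conjI impI allI)
    show "\<exists>R. is_arg_min ?area ?P R" using ex arg_min by blast
  next
    fix R assume "1 < L" "?P R"
    then show "is_arg_min ?area ?P R \<longleftrightarrow> (\<exists>m\<in>{A, B, C, D}. is_center_of_symmetry m R) \<and>
        is_isosceles_right_triangle (R \<inter> T)"
      using arg_min minimal triangle by blast
  next
    fix R assume "L = 1" "?P R"
    then show "is_arg_min ?area ?P R \<longleftrightarrow> (\<exists>m\<in>{A, B, C, D}. is_center_of_symmetry m R)"
      using arg_min minimal(1) square by blast
  qed
qed

end
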